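(* Let $G$ be a finite connected graph, $r\ge 1$, $v \in V(G)$, and $\mathrm{Supp}_r(v,G)=\{S_1,\dots,S_n\}$. If $\mathrm{Supp}_r(v,G)$ is connected and $N(v) \subseteq N[S_i]$ for each $i \in \{1,\dots,n\}$, then $$\mathrm{Ind}_r(G) \simeq \bigvee_{i=1}^n \Sigma^r (\mathrm{Ind}_r(G-N[S_i])).$$
   Context: For $r\ge 1$, $\mathrm{Ind}_r(G)$ is the simplicial complex on $V(G)$ whose simplices are the sets $A\subseteq V(G)$ such that every connected component of the induced subgraph $G[A]$ has at most $r$ vertices. For $S\subseteq V(G)$, $N(S)$ is the set of vertices adjacent to some vertex of $S$, $N[S]=N(S)\cup S$, $N(v)=N(\{v\})$, and $G-U$ denotes the induced subgraph $G[V(G)\setminus U]$. For $r\ge 0$, an $r$-support of $v$ in $G$ is a set $S\subseteq V(G)$ with $v\notin S$, $|S|=r$ and $G[S\cup\{v\}]$ connected; $\mathrm{Supp}_r(v,G)$ is the set of all $r$-supports of $v$. $\mathrm{Supp}_r(v,G)$ is called connected if $G[S]$ is connected for every $S\in\mathrm{Supp}_r(v,G)$. $\Sigma^r$ denotes the $r$-fold suspension, with the convention that the suspension of the empty space is $\mathbb{S}^0$ (so $\Sigma^r(\emptyset)\simeq \mathbb{S}^{r-1}$), and $\mathrm{Ind}_r$ of the graph with no vertices is the empty complex. *)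

theory Defs
  imports "HOL-Analysis.Analysis" "Graph_Theory.Digraph_Component"
begin

section \<open>Graphs\<close>

text \<open>
  Finite simple graphs are the digraphs satisfying the locale predicate \<^const>\<open>graph\<close>: finite,
  loop-free, without parallel arcs, and symmetric.  The induced subgraph $G[A]$ is
  \<^term>\<open>induce_subgraph G A\<close>; the library notion of a connected graph excludes the graph without
  vertices.
\<close>

abbreviation connected_graph :: "('a, 'b) pre_digraph \<Rightarrow> bool"
  where "connected_graph \<equiv> Digraph_Component.connected"

definition component_of_graph :: "('a, 'b) pre_digraph \<Rightarrow> ('a, 'b) pre_digraph \<Rightarrow> bool"
  where "component_of_graph G C \<longleftrightarrow> pre_digraph.max_subgraph G connected_graph C"

definition nbhd :: "('a, 'b) pre_digraph \<Rightarrow> 'a set \<Rightarrow> 'a set"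
  where "nbhd G S = {u \<in> verts G. \<exists>s\<in>S. s \<rightarrow>\<^bsub>G\<^esub> u}"

definition closed_nbhd :: "('a, 'b) pre_digraph \<Rightarrow> 'a set \<Rightarrow> 'a set"
  where "closed_nbhd G S = nbhd G S \<union> S"

definition delete_verts :: "('a, 'b) pre_digraph \<Rightarrow> 'a set \<Rightarrow> ('a, 'b) pre_digraph"
  where "delete_verts G U = induce_subgraph G (verts G - U)"

definition Supp :: "nat \<Rightarrow> 'a \<Rightarrow> ('a, 'b) pre_digraph \<Rightarrow> 'a set set"
  where "Supp r v G =
    {S. S \<subseteq> verts G \<and> v \<notin> S \<and> card S = r \<and> connected_graph (induce_subgraph G (insert v S))}"

definition Supp_connected :: "nat \<Rightarrow> 'a \<Rightarrow> ('a, 'b) pre_digraph \<Rightarrow> bool"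
  where "Supp_connected r v G \<longleftrightarrow> (\<forall>S\<in>Supp r v G. connected_graph (induce_subgraph G S))"


section \<open>Higher independence complexes and geometric realization\<close>

text \<open>
  Abstract simplicial complexes are families of finite sets; the empty set always belongs to
  \<open>Ind r G\<close>, and the realization of the complex with no other simplex is the empty space.
\<close>

definition Ind :: "nat \<Rightarrow> ('a, 'b) pre_digraph \<Rightarrow> 'a set set"
  where "Ind r G =
    {A. A \<subseteq> verts G \<and>
        (\<forall>C. component_of_graph (induce_subgraph G A) C \<longrightarrow> card (verts C) \<le> r)}"

text \<open>
  Points of the realization are given by their barycentric coordinates.  For a complex with finitely
  many vertices the subspace topology used here is the usual topology of the realization.
\<close>

definition realization :: "'a set set \<Rightarrow> ('a \<Rightarrow> real) topology"
  where "realization K =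
    subtopology (powertop_real UNIV)
      {x. (\<forall>a. 0 \<le> x a) \<and> {a. x a \<noteq> 0} \<in> K \<and> (\<Sum>a | x a \<noteq> 0. x a) = 1}"


section \<open>Quotients, suspensions and wedges\<close>

text \<open>
  The finest topology on \<open>Y\<close> making \<open>q\<close> continuous: the quotient topology on \<open>q ` topspace X\<close>,
  together with the points of \<open>Y\<close> outside this image as isolated points.
\<close>

definition final_topology :: "'a topology \<Rightarrow> ('a \<Rightarrow> 'b) \<Rightarrow> 'b set \<Rightarrow> 'b topology"
  where "final_topology X q Y =
    topology (\<lambda>U. U \<subseteq> Y \<and> openin X {x \<in> topspace X. q x \<in> U})"

lemma istopology_final_topology:
  "istopology (\<lambda>U. U \<subseteq> Y \<and> openin X {x \<in> topspace X. q x \<in> U})"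
proof -
  have "openin X {x \<in> topspace X. q x \<in> U \<inter> V}"
    if "openin X {x \<in> topspace X. q x \<in> U}" "openin X {x \<in> topspace X. q x \<in> V}" for U V
  proof -
    have "{x \<in> topspace X. q x \<in> U \<inter> V} = {x \<in> topspace X. q x \<in> U} \<inter> {x \<in> topspace X. q x \<in> V}"
      by blast
    with that show ?thesis by auto
  qed
  moreover have "openin X {x \<in> topspace X. q x \<in> \<Union>\<U>}"
    if "\<And>U. U \<in> \<U> \<Longrightarrow> openin X {x \<in> topspace X. q x \<in> U}" for \<U>
  proof -
    have "{x \<in> topspace X. q x \<in> \<Union>\<U>} = (\<Union>U\<in>\<U>. {x \<in> topspace X. q x \<in> U})"
      by blast
    with that show ?thesis by auto
  qed
  ultimately show ?thesis
    unfolding istopology_def by blast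
qed

lemma openin_final_topology:
  "openin (final_topology X q Y) U \<longleftrightarrow> U \<subseteq> Y \<and> openin X {x \<in> topspace X. q x \<in> U}"
  by (simp add: final_topology_def istopology_final_topology)

lemma topspace_final_topology:
  assumes "q ` topspace X \<subseteq> Y"
  shows "topspace (final_topology X q Y) = Y"
proof -
  have "{x \<in> topspace X. q x \<in> Y} = topspace X"
    using assms by blast
  then have "openin (final_topology X q Y) Y"
    by (simp add: openin_final_topology)
  then show ?thesis
    by (metis openin_final_topology openin_subset openin_topspace subset_antisym)
qed

lemma quotient_map_final_topology:
  "quotient_map X (final_topology X q (q ` topspace X)) q"
  by (auto simp: quotient_map_def topspace_final_topology openin_final_topology)

text \<open>
  The suspension of a space with points in some type has points in the same type, so that it can be
  iterated a variable number of times.  \<open>Base x\<close> is a point of the space one starts with, and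
  \<open>Meridian x t\<close> is the class of \<open>(x, t)\<close> with \<open>0 < t < 1\<close>.
\<close>

datatype 'a susp_point = Base 'a | North | South | Meridian "'a susp_point" real

definition susp_proj :: "'a susp_point \<times> real \<Rightarrow> 'a susp_point"
  where "susp_proj = (\<lambda>(x, t). if t = 0 then South else if t = 1 then North else Meridian x t)"

text \<open>
  The unreduced suspension: the quotient of $X \times [0,1]$ collapsing $X \times \{0\}$ and
  $X \times \{1\}$ to one pole each.  The poles are present also when $X$ is empty, so that the
  suspension of the empty space is the two-point discrete space.
\<close>

definition suspension :: "'a susp_point topology \<Rightarrow> 'a susp_point topology"
  where "suspension X =
    final_topology (prod_topology X (top_of_set {0..1})) susp_proj
      ({North, South} \<union> susp_proj ` (topspace X \<times> {0..1}))"

definition base_copy :: "'a topology \<Rightarrow> 'a susp_point topology"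
  where "base_copy X = final_topology X Base (Base ` topspace X)"

definition iterated_suspension :: "nat \<Rightarrow> 'a topology \<Rightarrow> 'a susp_point topology"
  where "iterated_suspension r X = (suspension ^^ r) (base_copy X)"

lemma homeomorphic_map_base_copy: "homeomorphic_map X (base_copy X) Base"
  unfolding base_copy_def
  by (rule bijective_open_imp_homeomorphic_map)
    (auto simp: quotient_imp_continuous_map quotient_map_final_topology topspace_final_topology
      open_map_def openin_final_topology inj_on_def image_iff conj_commute
      dest: openin_subset intro: back_subst[of "openin X"])

lemma topspace_suspension:
  "topspace (suspension X) = {North, South} \<union> susp_proj ` (topspace X \<times> {0..1})"
  unfolding suspension_def by (rule topspace_final_topology) auto

lemma quotient_map_suspension:
  assumes "topspace X \<noteq> {}"
  shows "quotient_map (prod_topology X (top_of_set {0..1})) (suspension X) susp_proj"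
proof -
  obtain x where x: "x \<in> topspace X" using assms by blast
  have "North = susp_proj (x, 1)" "South = susp_proj (x, 0)"
    by (auto simp: susp_proj_def)
  then have "{North, South} \<union> susp_proj ` (topspace X \<times> {0..1}) = susp_proj ` (topspace X \<times> {0..1})"
    using x by force
  then show ?thesis
    using quotient_map_final_topology[of "prod_topology X (top_of_set {0..1})" susp_proj]
    by (simp add: suspension_def)
qed

lemma suspension_empty:
  assumes "topspace X = {}"
  shows "suspension X = discrete_topology {North, South}"
  unfolding topology_eq suspension_def openin_final_topology openin_discrete_topology
    topspace_prod_topology assms by simp

text \<open>
  The wedge of a family of pointed spaces: the quotient of the disjoint union in which all the base
  points \<open>p i\<close> are identified to the single point \<open>None\<close>.  The empty wedge is a point.
\<close>

definition wedge_proj :: "('i \<Rightarrow> 'a) \<Rightarrow> 'i \<times> 'a \<Rightarrow> ('i \<times> 'a) option"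
  where "wedge_proj p = (\<lambda>(i, x). if x = p i then None else Some (i, x))"

definition wedge :: "'i set \<Rightarrow> ('i \<Rightarrow> 'a topology) \<Rightarrow> ('i \<Rightarrow> 'a) \<Rightarrow> ('i \<times> 'a) option topology"
  where "wedge I X p =
    final_topology (sum_topology X I) (wedge_proj p)
      (insert None (wedge_proj p ` topspace (sum_topology X I)))"

lemma wedge_empty: "wedge {} X p = discrete_topology {None}"
  by (auto simp: topology_eq wedge_def openin_final_topology)

lemma quotient_map_wedge:
  assumes "I \<noteq> {}" and "\<And>i. i \<in> I \<Longrightarrow> p i \<in> topspace (X i)"
  shows "quotient_map (sum_topology X I) (wedge I X p) (wedge_proj p)"
proof -
  obtain i where i: "i \<in> I" using assms by blast
  have "None = wedge_proj p (i, p i)"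
    by (auto simp: wedge_proj_def)
  then have "None \<in> wedge_proj p ` topspace (sum_topology X I)"
    using i assms(2) by (force simp: topspace_sum_topology)
  then show ?thesis
    using quotient_map_final_topology[of "sum_topology X I" "wedge_proj p"]
    by (simp add: wedge_def insert_absorb)
qed

text \<open>
  A pole serves as base point of an iterated suspension.
\<close>

lemma North_in_iterated_suspension:
  "r \<ge> 1 \<Longrightarrow> North \<in> topspace (iterated_suspension r X)"
  by (cases r) (auto simp: iterated_suspension_def topspace_suspension)

end

theory Submission
  imports Defs
begin

text \<open>
  A face of \<open>Ind r G\<close> outside the star of \<open>v\<close> contains an \<open>r\<close>-support \<open>S\<close> of \<open>v\<close>. Since \<open>S\<close> is
  connected with \<open>r\<close> vertices it is a component of the face, and since \<open>N(v) \<subseteq> N[S]\<close> it is the only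
  support in the face. So \<open>Ind r G\<close> is the star of \<open>v\<close> with the joins \<open>S * L\<^sub>S\<close> attached along
  \<open>\<partial>S * L\<^sub>S\<close>, where \<open>L\<^sub>S = Ind r (G - N[S])\<close>, and collapsing the contractible star leaves the wedge
  of the quotients \<open>(S * L\<^sub>S) / (\<partial>S * L\<^sub>S)\<close>.

  The \<open>r\<close>-fold suspension of \<open>L\<^sub>S\<close> is the join of \<open>L\<^sub>S\<close> with an octahedral \<open>(r - 1)\<close>-sphere, one
  of whose facets is identified with \<open>S\<close>. The part of this join outside the open facet contracts to
  a vertex, and collapsing it in every summand of the wedge leaves the same quotient.

  Both collapses multiply a point with the minimum of its coordinates over \<open>S\<close>. They are homotopy
  equivalences because subtracting a growing fraction of that minimum pushes a neighbourhood of the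
  collapsed subspace into it.
\<close>

section \<open>Collapsing shrinkable subsets\<close>

abbreviation unit_interval :: "real topology" where
  "unit_interval \<equiv> top_of_set {0..1}"

definition shrinking_homotopy :: "'a topology \<Rightarrow> 'a set \<Rightarrow> 'a \<Rightarrow> (real \<times> 'a \<Rightarrow> 'a) \<Rightarrow> bool" where
  "shrinking_homotopy X A p h \<longleftrightarrow>
    continuous_map (prod_topology unit_interval X) X h \<and>
    (\<forall>x\<in>topspace X. h (0, x) = x) \<and>
    (\<forall>t\<in>{0..1}. h (t, p) = p \<and> (\<forall>x\<in>A. h (t, x) \<in> A)) \<and>
    (\<forall>x\<in>A. h (1, x) = p)"

definition shrinkable :: "'a topology \<Rightarrow> 'a set \<Rightarrow> 'a \<Rightarrow> bool" where
  "shrinkable X A p \<longleftrightarrow> A \<subseteq> topspace X \<and> p \<in> A \<and> (\<exists>h. shrinking_homotopy X A p h)"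

lemma
  assumes "shrinking_homotopy X A p h"
  shows shrinking_homotopy_continuous: "continuous_map (prod_topology unit_interval X) X h"
    and shrinking_homotopy_0: "x \<in> topspace X \<Longrightarrow> h (0, x) = x"
    and shrinking_homotopy_base: "t \<in> {0..1} \<Longrightarrow> h (t, p) = p"
    and shrinking_homotopy_mem: "\<lbrakk>t \<in> {0..1}; x \<in> A\<rbrakk> \<Longrightarrow> h (t, x) \<in> A"
    and shrinking_homotopy_1: "x \<in> A \<Longrightarrow> h (1, x) = p"
  using assms by (auto simp: shrinking_homotopy_def)

lemma quotient_map_prod_unit_interval:
  assumes "quotient_map X Z f"
  shows "quotient_map (prod_topology unit_interval X) (prod_topology unit_interval Z)
      (\<lambda>(t, x). (t, f x))"
  using assms by (intro quotient_map_prod_right)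
    (auto simp: compact_imp_locally_compact_space
      compact_space_subtopology Hausdorff_space_subtopology)

lemma shrinkable_quotient_homotopy_equivalent:
  assumes shrinkable: "shrinkable X A p" and f: "quotient_map X Z f"
    and fibres: "\<And>x y. \<lbrakk>x \<in> topspace X; y \<in> topspace X\<rbrakk> \<Longrightarrow> f x = f y \<longleftrightarrow> x = y \<or> x \<in> A \<and> y \<in> A"
  shows "X homotopy_equivalent_space Z"
proof -
  obtain h where h: "shrinking_homotopy X A p h" and A: "A \<subseteq> topspace X"
    using shrinkable by (auto simp: shrinkable_def)
  note h_cont = shrinking_homotopy_continuous[OF h]
  have h_X: "h (t, x) \<in> topspace X" if "t \<in> {0..1}" "x \<in> topspace X" for t x
    using h_cont that by (force simp: continuous_map_def)
  have f_cont: "continuous_map X Z f"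
    using f by (rule quotient_imp_continuous_map)
  have f_onto: "f ` topspace X = topspace Z"
    using f by (rule quotient_imp_surjective_map)
  have "continuous_map X X (\<lambda>x. h (1, x))"
    using continuous_map_o_Pair[OF h_cont, of 1] by (simp add: o_def)
  then obtain g where g: "continuous_map Z X g" and g_f: "\<And>x. x \<in> topspace X \<Longrightarrow> g (f x) = h (1, x)"
    by (rule quotient_map_lift_exists[OF f]) (use fibres shrinking_homotopy_1[OF h] in auto)
  have "continuous_map (prod_topology unit_interval X) Z (f \<circ> h)"
    using h_cont f_cont by (rule continuous_map_compose)
  then obtain k where k: "continuous_map (prod_topology unit_interval Z) Z k"
    and k_lift: "\<And>q. q \<in> topspace (prod_topology unit_interval X) \<Longrightarrow>
      k ((\<lambda>(t, x). (t, f x)) q) = (f \<circ> h) q"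
    by (rule quotient_map_lift_exists[OF quotient_map_prod_unit_interval[OF f]])
      (use A shrinking_homotopy_mem[OF h] h_X in \<open>auto simp: fibres\<close>)
  have k_f: "k (t, f x) = f (h (t, x))" if "t \<in> {0..1}" "x \<in> topspace X" for t x
    using k_lift[of "(t, x)"] that by simp
  have "homotopic_with (\<lambda>x. True) X X id (g \<circ> f)"
    by (subst homotopic_with, simp, rule exI[of _ h])
      (auto simp: h_cont shrinking_homotopy_0[OF h] g_f)
  moreover have "homotopic_with (\<lambda>x. True) Z Z id (f \<circ> g)"
    by (subst homotopic_with, simp, rule exI[of _ k])
      (auto simp: k k_f shrinking_homotopy_0[OF h] g_f simp flip: f_onto)
  ultimately show ?thesis
    using f_cont g unfolding homotopy_equivalent_space_def by (blast intro: homotopic_with_symD)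
qed

lemma shrinkable_homeomorphic:
  assumes f: "homeomorphic_map X Y f" and shrinkable: "shrinkable Y (f ` A) (f p)"
    and A: "A \<subseteq> topspace X" "p \<in> A"
  shows "shrinkable X A p"
proof -
  obtain g where g: "homeomorphic_maps X Y f g"
    using f homeomorphic_map_maps by blast
  then have f_cont: "continuous_map X Y f" and g_cont: "continuous_map Y X g"
    and g_f: "\<And>x. x \<in> topspace X \<Longrightarrow> g (f x) = x"
    by (auto simp: homeomorphic_maps_def)
  obtain h where h: "shrinking_homotopy Y (f ` A) (f p) h"
    using shrinkable by (auto simp: shrinkable_def)
  define k where "k q = g (h (fst q, f (snd q)))" for q
  have "continuous_map (prod_topology unit_interval X) (prod_topology unit_interval Y)
      (\<lambda>(t, x). (t, f x))"
    using f_cont by (simp add: continuous_map_prod_top)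
  then have "continuous_map (prod_topology unit_interval X) X (g \<circ> (h \<circ> (\<lambda>(t, x). (t, f x))))"
    using shrinking_homotopy_continuous[OF h] g_cont by (intro continuous_map_compose)
  then have "continuous_map (prod_topology unit_interval X) X k"
    by (simp add: k_def[abs_def] o_def split_beta)
  moreover have "k (t, x) \<in> A" if "t \<in> {0..1}" "x \<in> A" for t x
    using shrinking_homotopy_mem[OF h that(1) imageI[OF that(2)]] A(1) g_f by (auto simp: k_def)
  moreover have "f x \<in> topspace Y" if "x \<in> topspace X" for x
    using f_cont that by (auto simp: continuous_map_def)
  moreover have "p \<in> topspace X" "x \<in> topspace X" if "x \<in> A" for x
    using A that by auto
  ultimately have "shrinking_homotopy X A p k"
    using A(2) shrinking_homotopy_0[OF h] shrinking_homotopy_base[OF h] shrinking_homotopy_1[OF h]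
    by (simp add: shrinking_homotopy_def k_def g_f)
  then show ?thesis using A by (auto simp: shrinkable_def)
qed

definition push_then_contract ::
  "('a \<Rightarrow> real) \<Rightarrow> (real \<times> 'a \<Rightarrow> 'a) \<Rightarrow> (real \<times> 'a \<Rightarrow> 'a) \<Rightarrow> real \<times> 'a \<Rightarrow> 'a" where
  "push_then_contract u push contract q =
    (if fst q \<le> u (snd q) then push q
     else contract (fst q - u (snd q), push (u (snd q), snd q)))"

lemma continuous_map_contract_after_push:
  assumes u: "continuous_map X euclideanreal u" and u_nonneg: "\<And>x. x \<in> topspace X \<Longrightarrow> 0 \<le> u x"
    and push: "continuous_map (prod_topology unit_interval X) X push"
    and push_A: "\<And>t x. \<lbrakk>t \<in> {0..1}; x \<in> topspace X; u x \<le> t\<rbrakk> \<Longrightarrow> push (t, x) \<in> A"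
    and contract: "continuous_map (prod_topology unit_interval (subtopology X A))
        (subtopology X A) contract"
    and f: "continuous_map Q X f" and \<tau>: "continuous_map Q euclideanreal \<tau>"
    and late: "\<And>q. q \<in> topspace Q \<Longrightarrow> u (f q) \<le> \<tau> q \<and> \<tau> q \<le> 1"
  shows "continuous_map Q X (\<lambda>q. contract (\<tau> q - u (f q), push (u (f q), f q)))"
proof -
  have f_X: "f q \<in> topspace X" if "q \<in> topspace Q" for q
    using f that by (auto simp: continuous_map_def)
  have bounds: "0 \<le> u (f q)" "u (f q) \<le> \<tau> q" "\<tau> q \<le> 1" if "q \<in> topspace Q" for q
    using that u_nonneg[OF f_X] late by auto
  have u_f: "continuous_map Q euclideanreal (\<lambda>q. u (f q))"
    using continuous_map_compose[OF f u] by (simp add: o_def)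
  then have "continuous_map Q unit_interval (\<lambda>q. u (f q))"
    using bounds by (intro continuous_map_into_subtopology) force+
  with f have "continuous_map Q (prod_topology unit_interval X) (\<lambda>q. (u (f q), f q))"
    by (simp add: continuous_map_paired)
  then have "continuous_map Q X (\<lambda>q. push (u (f q), f q))"
    using continuous_map_compose[OF _ push] by (auto simp: o_def)
  then have "continuous_map Q (subtopology X A) (\<lambda>q. push (u (f q), f q))"
    using bounds f_X push_A by (intro continuous_map_into_subtopology) force+
  moreover have "continuous_map Q unit_interval (\<lambda>q. \<tau> q - u (f q))"
    using bounds by (intro continuous_map_into_subtopology continuous_map_diff \<tau> u_f) force
  ultimately have "continuous_map Q (prod_topology unit_interval (subtopology X A))
      (\<lambda>q. (\<tau> q - u (f q), push (u (f q), f q)))"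
    by (simp add: continuous_map_paired)
  then have "continuous_map Q (subtopology X A) (\<lambda>q. contract (\<tau> q - u (f q), push (u (f q), f q)))"
    using continuous_map_compose[OF _ contract] by (auto simp: o_def)
  then show ?thesis
    by (rule continuous_map_into_fulltopology)
qed

lemma continuous_map_push_then_contract:
  assumes u: "continuous_map X euclideanreal u" and u_nonneg: "\<And>x. x \<in> topspace X \<Longrightarrow> 0 \<le> u x"
    and push: "continuous_map (prod_topology unit_interval X) X push"
    and push_A: "\<And>t x. \<lbrakk>t \<in> {0..1}; x \<in> topspace X; u x \<le> t\<rbrakk> \<Longrightarrow> push (t, x) \<in> A"
    and contract: "continuous_map (prod_topology unit_interval (subtopology X A))
        (subtopology X A) contract"
    and contract_0: "\<And>x. x \<in> A \<Longrightarrow> contract (0, x) = x"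
  shows "continuous_map (prod_topology unit_interval X) X (push_then_contract u push contract)"
  unfolding push_then_contract_def
proof (rule continuous_map_cases_le)
  let ?P = "prod_topology unit_interval X"
  show fst_cont: "continuous_map ?P euclideanreal fst"
    using continuous_map_fst by (rule continuous_map_into_fulltopology)
  show "continuous_map ?P euclideanreal (\<lambda>q. u (snd q))"
    using continuous_map_compose[OF continuous_map_snd u] by (simp add: o_def)
  show "continuous_map (subtopology ?P {q \<in> topspace ?P. fst q \<le> u (snd q)}) X push"
    using push by (rule continuous_map_from_subtopology)
  show "continuous_map (subtopology ?P {q \<in> topspace ?P. u (snd q) \<le> fst q}) X
      (\<lambda>q. contract (fst q - u (snd q), push (u (snd q), snd q)))"
    using u u_nonneg push push_A contract
  proof (rule continuous_map_contract_after_push)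
    show "continuous_map (subtopology ?P {q \<in> topspace ?P. u (snd q) \<le> fst q}) X snd"
      by (rule continuous_map_from_subtopology[OF continuous_map_snd])
    show "continuous_map (subtopology ?P {q \<in> topspace ?P. u (snd q) \<le> fst q}) euclideanreal fst"
      by (rule continuous_map_from_subtopology[OF fst_cont])
  qed auto
next
  fix q assume "q \<in> topspace (prod_topology unit_interval X)" "fst q = u (snd q)"
  then show "push q = contract (fst q - u (snd q), push (u (snd q), snd q))"
    using contract_0 push_A[of "fst q" "snd q"] by auto
qed

text \<open>The value \<open>u x\<close> is the time at which the homotopy \<open>push\<close> has carried \<open>x\<close> into \<open>A\<close>.\<close>

lemma shrinkable_zero_set:
  fixes u :: "'a \<Rightarrow> real"
  assumes A: "A = {x \<in> topspace X. u x = 0}"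
    and u: "continuous_map X euclideanreal u" and u_nonneg: "\<And>x. x \<in> topspace X \<Longrightarrow> 0 \<le> u x"
    and push: "continuous_map (prod_topology unit_interval X) X push"
    and push_0: "\<And>x. x \<in> topspace X \<Longrightarrow> push (0, x) = x"
    and push_zero: "\<And>t x. \<lbrakk>t \<in> {0..1}; x \<in> topspace X; u x \<le> t\<rbrakk> \<Longrightarrow> u (push (t, x)) = 0"
    and contractible: "shrinkable (subtopology X A) A p"
  shows "shrinkable X A p"
proof -
  have top_A: "topspace (subtopology X A) = A"
    by (auto simp: A)
  obtain contract where contract: "shrinking_homotopy (subtopology X A) A p contract" and "p \<in> A"
    using contractible by (auto simp: shrinkable_def)
  note contract_0 = shrinking_homotopy_0[OF contract, unfolded top_A]
  let ?h = "push_then_contract u push contract"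
  have "push (t, x) \<in> topspace X" if "t \<in> {0..1}" "x \<in> topspace X" for t x
    using push that by (force simp: continuous_map_def)
  then have "continuous_map (prod_topology unit_interval X) X ?h"
    using u u_nonneg push push_zero shrinking_homotopy_continuous[OF contract] contract_0
    by (intro continuous_map_push_then_contract[where A = A]) (auto simp: A)
  moreover have "?h (0, x) = x" if "x \<in> topspace X" for x
    using that u_nonneg push_0 by (simp add: push_then_contract_def)
  moreover have "?h (t, x) = contract (t, x)" if "t \<in> {0..1}" "x \<in> A" for t x
    using that contract_0 push_0[of x] by (auto simp: push_then_contract_def A)
  ultimately have "shrinking_homotopy X A p ?h"
    using \<open>p \<in> A\<close> shrinking_homotopy_base[OF contract] shrinking_homotopy_mem[OF contract]
      shrinking_homotopy_1[OF contract]
    by (simp add: shrinking_homotopy_def)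
  with \<open>p \<in> A\<close> show ?thesis by (auto simp: shrinkable_def A)
qed

section \<open>Final topologies and wedges\<close>

lemma continuous_map_into_final_topology:
  "q ` topspace X \<subseteq> Y \<Longrightarrow> continuous_map X (final_topology X q Y) q"
  by (auto simp: continuous_map_def topspace_final_topology openin_final_topology)

lemma continuous_map_from_final_topology:
  assumes "q ` topspace X \<subseteq> Y" "continuous_map X Z (g \<circ> q)" "g \<in> Y \<rightarrow> topspace Z"
  shows "continuous_map (final_topology X q Y) Z g"
  unfolding continuous_map_def
proof (intro conjI allI impI)
  show "g \<in> topspace (final_topology X q Y) \<rightarrow> topspace Z"
    using assms by (simp add: topspace_final_topology)
  fix U assume "openin Z U"
  then have "openin X {x \<in> topspace X. (g \<circ> q) x \<in> U}"
    using assms(2) by (rule openin_continuous_map_preimage[rotated])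
  moreover have "{x \<in> topspace X. (g \<circ> q) x \<in> U} =
      {x \<in> topspace X. q x \<in> {y \<in> topspace (final_topology X q Y). g y \<in> U}}"
    using assms(1) by (auto simp: topspace_final_topology)
  ultimately show "openin (final_topology X q Y) {y \<in> topspace (final_topology X q Y). g y \<in> U}"
    using assms(1) by (auto simp: openin_final_topology topspace_final_topology)
qed

lemma compact_space_final_topology:
  assumes "compact_space X" "q ` topspace X \<subseteq> Y" "finite (Y - q ` topspace X)"
  shows "compact_space (final_topology X q Y)"
proof -
  have top: "topspace (final_topology X q Y) = Y"
    using assms(2) by (rule topspace_final_topology)
  have "compactin (final_topology X q Y) (q ` topspace X)"
    using image_compactin[OF _ continuous_map_into_final_topology[OF assms(2)]] assms(1)
    by (simp add: compact_space_def)
  moreover have "compactin (final_topology X q Y) (Y - q ` topspace X)"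
    using assms(3) top by (intro finite_imp_compactin) auto
  ultimately have "compactin (final_topology X q Y) (q ` topspace X \<union> (Y - q ` topspace X))"
    by (rule compactin_Un)
  moreover have "q ` topspace X \<union> (Y - q ` topspace X) = Y" using assms(2) by blast
  ultimately show ?thesis by (simp add: compact_space_def top)
qed

lemma compact_space_suspension:
  assumes "compact_space X"
  shows "compact_space (suspension X)"
  unfolding suspension_def
proof (rule compact_space_final_topology)
  show "compact_space (prod_topology X unit_interval)"
    using assms by (simp add: compact_space_prod_topology compact_space_subtopology)
qed (auto intro: finite_subset[of _ "{North, South}"])

lemma compact_space_sum_topology:
  assumes "finite I" "\<And>i. i \<in> I \<Longrightarrow> compact_space (X i)"
  shows "compact_space (sum_topology X I)"
proof -
  have "compactin (sum_topology X I) (Pair i ` topspace (X i))" if "i \<in> I" for i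
    using image_compactin[OF _ continuous_map_component_injection[OF that]] assms(2)[OF that]
    by (simp add: compact_space_def)
  then have "compactin (sum_topology X I) (\<Union>((\<lambda>i. Pair i ` topspace (X i)) ` I))"
    using assms(1) by (intro compactin_Union) auto
  moreover have "\<Union>((\<lambda>i. Pair i ` topspace (X i)) ` I) = topspace (sum_topology X I)"
    by auto
  ultimately show ?thesis by (simp add: compact_space_def)
qed

lemma topspace_wedge:
  "topspace (wedge I X p) = insert None (wedge_proj p ` topspace (sum_topology X I))"
  unfolding wedge_def by (rule topspace_final_topology) blast

lemma compact_space_wedge:
  assumes "finite I" "\<And>i. i \<in> I \<Longrightarrow> compact_space (X i)"
  shows "compact_space (wedge I X p)"
  unfolding wedge_def
  by (rule compact_space_final_topology)
    (use assms in \<open>auto simp: compact_space_sum_topology intro: finite_subset[of _ "{None}"]\<close>)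

lemma continuous_map_from_sum_topology:
  assumes "\<And>i. i \<in> I \<Longrightarrow> continuous_map (X i) Y (\<lambda>x. f (i, x))"
  shows "continuous_map (sum_topology X I) Y f"
  unfolding continuous_map_def
proof (intro conjI allI impI)
  show "f \<in> topspace (sum_topology X I) \<rightarrow> topspace Y"
    using assms by (fastforce simp: continuous_map_def)
  fix U assume U: "openin Y U"
  have "openin (X i) {x. (i, x) \<in> {x \<in> topspace (sum_topology X I). f x \<in> U}}" if "i \<in> I" for i
    using openin_continuous_map_preimage[OF assms[OF that] U] that by simp
  then show "openin (sum_topology X I) {x \<in> topspace (sum_topology X I). f x \<in> U}"
    by (auto simp: openin_sum_topology)
qed

lemma continuous_map_from_prod_sum_topology:
  assumes "\<And>i. i \<in> I \<Longrightarrow> continuous_map (prod_topology Z (X i)) Y (\<lambda>(z, x). f (z, i, x))"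
  shows "continuous_map (prod_topology Z (sum_topology X I)) Y f"
  unfolding continuous_map_def
proof (intro conjI allI impI)
  have "f (z, i, x) \<in> topspace Y" if "z \<in> topspace Z" "i \<in> I" "x \<in> topspace (X i)" for z i x
    using funcset_mem[OF continuous_map_funspace[OF assms[OF that(2)]], of "(z, x)"] that(1,3)
    by simp
  then show "f \<in> topspace (prod_topology Z (sum_topology X I)) \<rightarrow> topspace Y"
    by auto
  fix U assume U: "openin Y U"
  show "openin (prod_topology Z (sum_topology X I))
      {q \<in> topspace (prod_topology Z (sum_topology X I)). f q \<in> U}"
    unfolding openin_prod_topology_alt
  proof (intro allI impI)
    fix z q assume "(z, q) \<in> {q \<in> topspace (prod_topology Z (sum_topology X I)). f q \<in> U}"
    then obtain i x where q: "q = (i, x)" "i \<in> I"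
      and zx: "z \<in> topspace Z" "x \<in> topspace (X i)" "f (z, i, x) \<in> U"
      by auto
    let ?preimage = "{w \<in> topspace (prod_topology Z (X i)). (\<lambda>(z, x). f (z, i, x)) w \<in> U}"
    have "openin (prod_topology Z (X i)) ?preimage"
      using assms[OF q(2)] U by (rule openin_continuous_map_preimage)
    moreover have "(z, x) \<in> ?preimage" using zx by simp
    ultimately obtain T W where TW:
      "openin Z T" "openin (X i) W" "z \<in> T" "x \<in> W" "T \<times> W \<subseteq> ?preimage"
      unfolding openin_prod_topology_alt by meson
    moreover have "openin (sum_topology X I) (Pair i ` W)"
      using open_map_component_injection[OF q(2), of X] TW(2) by (simp add: open_map_def)
    ultimately show "\<exists>T W. openin Z T \<and> openin (sum_topology X I) W \<and> z \<in> T \<and> q \<in> W \<and>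
        T \<times> W \<subseteq> {q \<in> topspace (prod_topology Z (sum_topology X I)). f q \<in> U}"
      using q by (intro exI[of _ T] exI[of _ "Pair i ` W"]) auto
  qed
qed

lemma continuous_map_from_prod_wedge:
  assumes "I \<noteq> {}" "\<And>i. i \<in> I \<Longrightarrow> p i \<in> topspace (X i)"
    and "\<And>i. i \<in> I \<Longrightarrow> continuous_map (prod_topology unit_interval (X i)) Y
        (\<lambda>(t, x). h (t, wedge_proj p (i, x)))"
  shows "continuous_map (prod_topology unit_interval (wedge I X p)) Y h"
proof (rule continuous_compose_quotient_map)
  show "quotient_map (prod_topology unit_interval (sum_topology X I))
      (prod_topology unit_interval (wedge I X p))
      (\<lambda>(t, x). (t, wedge_proj p x))"
    using assms(1,2) by (intro quotient_map_prod_unit_interval quotient_map_wedge)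
  show "continuous_map (prod_topology unit_interval (sum_topology X I)) Y
      (h \<circ> (\<lambda>(t, x). (t, wedge_proj p x)))"
    using assms(3) by (intro continuous_map_from_prod_sum_topology) (simp add: o_def)
qed

definition wedge_homotopy ::
  "('i \<Rightarrow> 'a) \<Rightarrow> ('i \<Rightarrow> real \<times> 'a \<Rightarrow> 'a) \<Rightarrow> real \<times> ('i \<times> 'a) option \<Rightarrow> ('i \<times> 'a) option" where
  "wedge_homotopy p k =
      (\<lambda>(t, w). case w of None \<Rightarrow> None | Some (i, x) \<Rightarrow> wedge_proj p (i, k i (t, x)))"

lemma wedge_homotopy_None [simp]: "wedge_homotopy p k (t, None) = None"
  by (simp add: wedge_homotopy_def)

lemma wedge_homotopy_wedge_proj:
  assumes "k i (t, p i) = p i"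
  shows "wedge_homotopy p k (t, wedge_proj p (i, x)) = wedge_proj p (i, k i (t, x))"
  using assms by (auto simp: wedge_homotopy_def wedge_proj_def)

lemma continuous_map_wedge_homotopy:
  assumes "I \<noteq> {}" and p: "\<And>i. i \<in> I \<Longrightarrow> p i \<in> topspace (X i)"
    and k: "\<And>i. i \<in> I \<Longrightarrow> continuous_map (prod_topology unit_interval (X i)) (X i) (k i)"
    and k_base: "\<And>i t. \<lbrakk>i \<in> I; t \<in> {0..1}\<rbrakk> \<Longrightarrow> k i (t, p i) = p i"
  shows "continuous_map (prod_topology unit_interval (wedge I X p)) (wedge I X p)
      (wedge_homotopy p k)"
  using assms(1) p
proof (rule continuous_map_from_prod_wedge)
  fix i assume i: "i \<in> I"
  have "continuous_map (prod_topology unit_interval (X i)) (wedge I X p)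
      (wedge_proj p \<circ> (Pair i \<circ> k i))"
    using k[OF i] continuous_map_component_injection[OF i]
      quotient_imp_continuous_map[OF quotient_map_wedge[OF assms(1) p]]
    by (intro continuous_map_compose)
  then show "continuous_map (prod_topology unit_interval (X i)) (wedge I X p)
      (\<lambda>(t, x). wedge_homotopy p k (t, wedge_proj p (i, x)))"
    by (rule continuous_map_eq) (auto simp: wedge_homotopy_wedge_proj k_base i)
qed

lemma shrinkable_wedge:
  assumes "\<And>i. i \<in> I \<Longrightarrow> shrinkable (X i) (A i) (p i)"
  shows "shrinkable (wedge I X p) (insert None (wedge_proj p ` Sigma I A)) None"
proof (cases "I = {}")
  case True
  then show ?thesis
    by (auto simp: shrinkable_def shrinking_homotopy_def wedge_empty
        intro!: exI[of _ snd] continuous_map_snd)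
next
  case False
  let ?W = "wedge I X p" and ?B = "insert None (wedge_proj p ` Sigma I A)"
  have "\<forall>i\<in>I. \<exists>h. shrinking_homotopy (X i) (A i) (p i) h"
    using assms by (simp add: shrinkable_def)
  then obtain k where "\<forall>i\<in>I. shrinking_homotopy (X i) (A i) (p i) (k i)"
    by (auto dest: bchoice)
  note k = this[rule_format]
  have A: "A i \<subseteq> topspace (X i)" and p: "p i \<in> topspace (X i)" if "i \<in> I" for i
    using assms[OF that] by (auto simp: shrinkable_def)
  let ?h = "wedge_homotopy p k"
  have h_proj: "?h (t, wedge_proj p (i, x)) = wedge_proj p (i, k i (t, x))"
    if "t \<in> {0..1}" "i \<in> I" for t i x
    using shrinking_homotopy_base[OF k[OF that(2)] that(1)] by (rule wedge_homotopy_wedge_proj)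
  have "continuous_map (prod_topology unit_interval ?W) ?W ?h"
    using False p shrinking_homotopy_continuous[OF k] shrinking_homotopy_base[OF k]
    by (rule continuous_map_wedge_homotopy)
  moreover have "?h (0, w) = w" if "w \<in> topspace ?W" for w
    using that by (auto simp: topspace_wedge h_proj shrinking_homotopy_0[OF k])
  moreover have "?h (t, w) \<in> ?B" if "t \<in> {0..1}" "w \<in> ?B" for t w
    using that by (auto simp: h_proj shrinking_homotopy_mem[OF k])
  moreover have "?h (1, w) = None" if "w \<in> ?B" for w
    using that by (auto simp: h_proj shrinking_homotopy_1[OF k]) (simp add: wedge_proj_def)
  ultimately have "shrinking_homotopy ?W ?B None ?h"
    by (simp add: shrinking_homotopy_def)
  moreover have "?B \<subseteq> topspace ?W"
    unfolding topspace_wedge by (intro insert_mono image_mono) (auto dest: subsetD[OF A])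
  ultimately show ?thesis by (auto simp: shrinkable_def)
qed

section \<open>Signed joins and iterated suspensions\<close>

definition finite_complex :: "'a set \<Rightarrow> 'a set set \<Rightarrow> bool" where
  "finite_complex V L \<longleftrightarrow> finite V \<and> L \<subseteq> Pow V \<and> {} \<in> L \<and> (\<forall>A\<in>L. Pow A \<subseteq> L)"

lemma
  assumes "finite_complex V L"
  shows finite_complex_finite: "finite V"
    and finite_complex_face_subset: "A \<in> L \<Longrightarrow> A \<subseteq> V"
    and finite_complex_empty: "{} \<in> L"
    and finite_complex_downward: "\<lbrakk>A \<in> L; B \<subseteq> A\<rbrakk> \<Longrightarrow> B \<in> L"
  using assms by (auto simp: finite_complex_def)

text \<open>
  The join of the octahedral sphere with vertices \<open>\<plusminus>s\<close>, \<open>s \<in> T\<close>, and a complex \<open>L\<close>: a negative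
  coordinate at \<open>s\<close> is a weight on the vertex \<open>-s\<close>.
\<close>

definition signed_join :: "'a set \<Rightarrow> 'a set \<Rightarrow> 'a set set \<Rightarrow> ('a \<Rightarrow> real) set" where
  "signed_join V T L = {x. (\<forall>a. a \<notin> V \<longrightarrow> x a = 0) \<and> (\<forall>a. a \<notin> T \<longrightarrow> 0 \<le> x a) \<and>
     {a. a \<notin> T \<and> x a \<noteq> 0} \<in> L \<and> (\<Sum>a\<in>V. \<bar>x a\<bar>) = 1}"

lemma
  assumes "x \<in> signed_join V T L"
  shows signed_join_outside: "a \<notin> V \<Longrightarrow> x a = 0"
    and signed_join_nonneg: "a \<notin> T \<Longrightarrow> 0 \<le> x a"
    and signed_join_face: "{a. a \<notin> T \<and> x a \<noteq> 0} \<in> L"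
    and signed_join_sum: "(\<Sum>a\<in>V. \<bar>x a\<bar>) = 1"
  using assms by (simp_all add: signed_join_def)

lemma signed_join_abs_le_1:
  assumes "x \<in> signed_join V T L" "finite V"
  shows "\<bar>x a\<bar> \<le> 1"
proof (cases "a \<in> V")
  case True
  then have "\<bar>x a\<bar> \<le> (\<Sum>a\<in>V. \<bar>x a\<bar>)" using assms(2) by (intro member_le_sum) auto
  then show ?thesis using signed_join_sum[OF assms(1)] by simp
next
  case False
  then show ?thesis using signed_join_outside[OF assms(1)] by simp
qed

definition axis_point :: "'a \<Rightarrow> real \<Rightarrow> 'a \<Rightarrow> real" where
  "axis_point b c = (\<lambda>a. if a = b then c else 0)"

lemma axis_point_simps [simp]: "axis_point b c b = c" "a \<noteq> b \<Longrightarrow> axis_point b c a = 0"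
  by (auto simp: axis_point_def)

lemma sum_abs_axis_point:
  assumes "finite V" "b \<in> V"
  shows "(\<Sum>a\<in>V. \<bar>axis_point b c a\<bar>) = \<bar>c\<bar>"
proof -
  have "(\<Sum>a\<in>V. \<bar>axis_point b c a\<bar>) = (\<Sum>a\<in>V. if a = b then \<bar>c\<bar> else 0)"
    by (intro sum.cong) (auto simp: axis_point_def)
  then show ?thesis using assms by simp
qed

lemma axis_point_in_signed_join:
  assumes "finite V" "b \<in> V" "{b} - T \<in> L" "\<bar>c\<bar> = 1" "b \<in> T \<or> 0 \<le> c"
  shows "axis_point b c \<in> signed_join V T L"
proof -
  have "{a. a \<notin> T \<and> axis_point b c a \<noteq> 0} = {b} - T"
    using assms(4) by (auto simp: axis_point_def)
  moreover have "axis_point b c a = 0" if "a \<notin> V" for a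
    using assms(2) that by (auto simp: axis_point_def)
  moreover have "0 \<le> axis_point b c a" if "a \<notin> T" for a
    using assms(5) that by (auto simp: axis_point_def)
  ultimately show ?thesis
    using assms(3,4) sum_abs_axis_point[OF assms(1,2)] by (simp add: signed_join_def)
qed

lemma signed_join_eq_axis_point:
  assumes "finite V" "b \<in> V" "x \<in> signed_join V T L" "\<bar>x b\<bar> = 1"
  shows "x = axis_point b (x b)"
proof
  fix a
  have "(\<Sum>a\<in>V - {b}. \<bar>x a\<bar>) = 0"
    using assms signed_join_sum[OF assms(3)] by (simp add: sum.remove)
  then have "\<forall>a\<in>V - {b}. \<bar>x a\<bar> = 0"
    using assms(1) by (subst sum_nonneg_eq_0_iff[symmetric]) auto
  then show "x a = axis_point b (x b) a"
    using signed_join_outside[OF assms(3)] by (cases "a \<in> V") (auto simp: axis_point_def)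
qed

lemma realization_eq_signed_join:
  assumes "finite_complex V K"
  shows "realization K = top_of_set (signed_join V {} K)"
proof -
  have "{x. (\<forall>a. 0 \<le> x a) \<and> {a. x a \<noteq> 0} \<in> K \<and> (\<Sum>a | x a \<noteq> 0. x a) = 1} = signed_join V {} K"
    (is "?realization = ?join")
  proof (intro set_eqI)
    fix x :: "'a \<Rightarrow> real"
    have "(\<Sum>a | x a \<noteq> 0. x a) = (\<Sum>a\<in>V. \<bar>x a\<bar>)" if "\<And>a. 0 \<le> x a" "{a. x a \<noteq> 0} \<subseteq> V"
      using that finite_complex_finite[OF assms] by (intro sum.mono_neutral_cong_left) auto
    then show "x \<in> ?realization \<longleftrightarrow> x \<in> ?join"
      using finite_complex_face_subset[OF assms, of "{a. x a \<noteq> 0}"] by (auto simp: signed_join_def)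
  qed
  then show ?thesis
    by (simp add: realization_def euclidean_product_topology)
qed

lemma Hausdorff_space_top_of_set_fun:
  "Hausdorff_space (top_of_set (X :: ('a \<Rightarrow> 'b::metric_space) set))"
proof -
  have "Hausdorff_space (euclidean :: ('a \<Rightarrow> 'b) topology)"
    by (subst euclidean_product_topology[symmetric])
      (simp add: Hausdorff_space_product_topology)
  then show ?thesis by (rule Hausdorff_space_subtopology)
qed

lemma continuous_on_coordinate: "continuous_on X (\<lambda>x. x a)"
  by (rule continuous_on_subset[OF continuous_on_product_coordinates subset_UNIV])

lemma continuous_on_snd_coordinate: "continuous_on X (\<lambda>q. snd q a)"
  by (rule continuous_on_compose2[OF continuous_on_coordinate[of UNIV]])
    (auto intro: continuous_on_snd[OF continuous_on_id])

lemma compact_signed_join: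
  assumes "finite_complex V L"
  shows "compact (signed_join V T L)"
proof -
  define cube :: "('a \<Rightarrow> real) set" where "cube = PiE UNIV (\<lambda>_. {-1..1})"
  define carrier :: "'a set \<Rightarrow> ('a \<Rightarrow> real) set" where
    "carrier A = {x. (\<forall>a. a \<in> V \<or> x a = 0) \<and> (\<forall>a. a \<in> T \<or> 0 \<le> x a) \<and>
      (\<forall>a. a \<in> A \<or> a \<in> T \<or> x a = 0) \<and> (\<Sum>a\<in>V. \<bar>x a\<bar>) = 1}" for A
  have "compactin (powertop_real UNIV) cube"
    unfolding cube_def by (subst compactin_PiE) auto
  then have "compact cube" by (simp add: euclidean_product_topology)
  moreover have "closed (carrier A)" for A
    unfolding carrier_def
    by (intro closed_Collect_conj closed_Collect_all closed_Collect_disj closed_Collect_const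
        closed_Collect_eq closed_Collect_le continuous_intros continuous_on_coordinate)
  ultimately have "compact (cube \<inter> carrier A)" for A
    by (rule compact_Int_closed)
  moreover have "finite L" using assms by (auto simp: finite_complex_def intro: finite_subset)
  ultimately have "compact (\<Union>A\<in>L. cube \<inter> carrier A)"
    by (intro compact_UN) auto
  also have "(\<Union>A\<in>L. cube \<inter> carrier A) = signed_join V T L"
  proof (intro equalityI subsetI)
    fix x assume "x \<in> (\<Union>A\<in>L. cube \<inter> carrier A)"
    then obtain A where "A \<in> L" "x \<in> carrier A" by blast
    moreover from this have "{a. a \<notin> T \<and> x a \<noteq> 0} \<subseteq> A"
      by (auto simp: carrier_def)
    ultimately show "x \<in> signed_join V T L"
      using finite_complex_downward[OF assms] by (auto simp: carrier_def signed_join_def)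
  next
    fix x assume x: "x \<in> signed_join V T L"
    have "x a \<in> {-1..1}" for a
      using signed_join_abs_le_1[OF x finite_complex_finite[OF assms], of a] by auto
    then have "x \<in> cube" by (auto simp: cube_def PiE_iff)
    moreover have "x \<in> carrier {a. a \<notin> T \<and> x a \<noteq> 0}"
      using x by (auto simp: carrier_def signed_join_def)
    ultimately show "x \<in> (\<Union>A\<in>L. cube \<inter> carrier A)" using signed_join_face[OF x] by blast
  qed
  finally show ?thesis .
qed

lemma compact_space_homeomorphic_signed_join:
  assumes "finite_complex V L" "homeomorphic_map Y (top_of_set (signed_join V T L)) \<theta>"
  shows "compact_space Y"
  using homeomorphic_compact_space[OF homeomorphic_map_imp_homeomorphic_space[OF assms(2)]]
    compact_signed_join[OF assms(1)] by (simp add: compact_space_subtopology)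

definition susp_join :: "'a \<Rightarrow> ('a \<Rightarrow> real) \<Rightarrow> real \<Rightarrow> 'a \<Rightarrow> real" where
  "susp_join b x t = (\<lambda>a. (1 - \<bar>2 * t - 1\<bar>) * x a + axis_point b (1 - 2 * t) a)"

definition suspension_coordinates ::
  "'a \<Rightarrow> ('b susp_point \<Rightarrow> 'a \<Rightarrow> real) \<Rightarrow> 'b susp_point \<Rightarrow> 'a \<Rightarrow> real" where
  "suspension_coordinates b \<theta> p = (case p of Base _ \<Rightarrow> undefined
    | North \<Rightarrow> axis_point b (- 1)
    | South \<Rightarrow> axis_point b 1
    | Meridian y t \<Rightarrow> susp_join b (\<theta> y) t)"

lemma suspension_coordinates_simps [simp]:
  "suspension_coordinates b \<theta> North = axis_point b (- 1)"
  "suspension_coordinates b \<theta> South = axis_point b 1"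
  "suspension_coordinates b \<theta> (Meridian y t) = susp_join b (\<theta> y) t"
  by (simp_all add: suspension_coordinates_def)

lemma suspension_coordinates_susp_proj:
  "suspension_coordinates b \<theta> (susp_proj (y, t)) = susp_join b (\<theta> y) t"
  by (auto simp: susp_proj_def susp_join_def)

lemma topspace_suspension_eq:
  "topspace (suspension Y) = {North, South} \<union> {Meridian y t | y t. y \<in> topspace Y \<and> 0 < t \<and> t < 1}"
    (is "_ = ?points")
proof
  show "topspace (suspension Y) \<subseteq> ?points"
    by (auto simp: topspace_suspension susp_proj_def)
  have "Meridian y t \<in> susp_proj ` (topspace Y \<times> {0..1})" if "y \<in> topspace Y" "0 < t" "t < 1"
    for y t
    by (rule image_eqI[of _ _ "(y, t)"]) (use that in \<open>auto simp: susp_proj_def\<close>)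
  then show "?points \<subseteq> topspace (suspension Y)"
    by (auto simp: topspace_suspension)
qed

lemma continuous_map_suspension_coordinates:
  assumes "continuous_map Y euclidean \<theta>"
  shows "continuous_map (suspension Y) euclidean (suspension_coordinates b \<theta>)"
  unfolding suspension_def
proof (rule continuous_map_from_final_topology)
  let ?P = "prod_topology Y unit_interval"
  have "continuous_map Y (powertop_real UNIV) \<theta>"
    using assms by (simp add: euclidean_product_topology)
  then have \<theta>: "continuous_map Y euclideanreal (\<lambda>y. \<theta> y a)" for a
    by (simp add: continuous_map_componentwise_UNIV)
  have "continuous_map ?P euclideanreal (\<lambda>p. \<theta> (fst p) a)" for a
    using continuous_map_compose[OF continuous_map_fst \<theta>] by (simp add: o_def)
  moreover have "continuous_map ?P euclideanreal snd"
    using continuous_map_snd by (rule continuous_map_into_fulltopology)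
  ultimately have "continuous_map ?P euclideanreal (\<lambda>p. susp_join b (\<theta> (fst p)) (snd p) a)" for a
    by (cases "a = b") (auto simp: susp_join_def intro!: continuous_intros)
  then have "continuous_map ?P euclidean (\<lambda>p. susp_join b (\<theta> (fst p)) (snd p))"
    by (subst euclidean_product_topology[symmetric]) (simp add: continuous_map_componentwise_UNIV)
  then show "continuous_map ?P euclidean (suspension_coordinates b \<theta> \<circ> susp_proj)"
    by (rule continuous_map_eq) (auto simp: suspension_coordinates_susp_proj)
qed auto

context
  fixes V T :: "'a set" and L :: "'a set set" and b :: 'a
  assumes complex: "finite_complex V L" and b_in_V: "b \<in> V" and b_notin_T: "b \<notin> T"
    and b_notin_L: "b \<notin> \<Union>L"
begin

lemma signed_join_apex_zero: "x \<in> signed_join V T L \<Longrightarrow> x b = 0"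
  using b_notin_T b_notin_L by (auto simp: signed_join_def)

lemma susp_join_apex: "x \<in> signed_join V T L \<Longrightarrow> susp_join b x t b = 1 - 2 * t"
  by (simp add: susp_join_def signed_join_apex_zero)

lemma susp_join_in_signed_join:
  assumes x: "x \<in> signed_join V T L" and t: "t \<in> {0..1}"
  shows "susp_join b x t \<in> signed_join V (insert b T) L"
proof -
  let ?scale = "1 - \<bar>2 * t - 1\<bar>"
  have scale: "0 \<le> ?scale" using t by (auto simp: abs_if)
  have "\<bar>susp_join b x t a\<bar> = ?scale * \<bar>x a\<bar> + \<bar>axis_point b (1 - 2 * t) a\<bar>" for a
    using scale signed_join_apex_zero[OF x] by (cases "a = b") (auto simp: susp_join_def abs_mult)
  then have "(\<Sum>a\<in>V. \<bar>susp_join b x t a\<bar>) = ?scale * (\<Sum>a\<in>V. \<bar>x a\<bar>) + \<bar>1 - 2 * t\<bar>"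
    using sum_abs_axis_point[OF finite_complex_finite[OF complex] b_in_V]
    by (simp add: sum.distrib sum_distrib_left)
  also have "\<dots> = 1" using signed_join_sum[OF x] by (simp add: abs_minus_commute)
  finally have "(\<Sum>a\<in>V. \<bar>susp_join b x t a\<bar>) = 1" .
  moreover have "{a. a \<notin> insert b T \<and> susp_join b x t a \<noteq> 0} =
      (if ?scale = 0 then {} else {a. a \<notin> T \<and> x a \<noteq> 0})"
    using signed_join_apex_zero[OF x] by (auto simp: susp_join_def axis_point_def)
  then have "{a. a \<notin> insert b T \<and> susp_join b x t a \<noteq> 0} \<in> L"
    using signed_join_face[OF x] finite_complex_empty[OF complex] by simp
  moreover have "susp_join b x t a = 0" if "a \<notin> V" for a
    using signed_join_outside[OF x that] that b_in_V by (auto simp: susp_join_def axis_point_def)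
  moreover have "0 \<le> susp_join b x t a" if "a \<notin> insert b T" for a
    using signed_join_nonneg[OF x] that scale by (auto simp: susp_join_def)
  ultimately show ?thesis by (simp add: signed_join_def)
qed

lemma susp_join_inject:
  assumes "x \<in> signed_join V T L" "y \<in> signed_join V T L" "0 < t" "t < 1"
    and eq: "susp_join b x t = susp_join b y u"
  shows "x = y \<and> t = u"
proof -
  have tu: "t = u" using fun_cong[OF eq, of b] assms(1,2) by (simp add: susp_join_apex)
  have "1 - \<bar>2 * t - 1\<bar> \<noteq> 0" using assms(3,4) by (auto simp: abs_if)
  then have "x a = y a" for a using fun_cong[OF eq, of a] tu by (simp add: susp_join_def)
  with tu show ?thesis by blast
qed

lemma signed_join_insert_cases:
  assumes x: "x \<in> signed_join V (insert b T) L"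
  obtains (pole) "x = axis_point b 1 \<or> x = axis_point b (- 1)"
  | (meridian) y t where "y \<in> signed_join V T L" "0 < t" "t < 1" "x = susp_join b y t"
proof (cases "\<bar>x b\<bar> = 1")
  case True
  then have "x b = 1 \<or> x b = - 1" by linarith
  then show ?thesis
    using pole signed_join_eq_axis_point[OF finite_complex_finite[OF complex] b_in_V x True]
    by metis
next
  case False
  define scale where "scale = 1 - \<bar>x b\<bar>"
  have sum: "(\<Sum>a\<in>V - {b}. \<bar>x a\<bar>) = scale"
    using signed_join_sum[OF x] finite_complex_finite[OF complex] b_in_V
    by (simp add: sum.remove scale_def)
  then have scale: "0 < scale" using False sum_nonneg[of "V - {b}" "\<lambda>a. \<bar>x a\<bar>"]
    by (simp add: scale_def)
  define y where "y a = (if a = b then 0 else x a / scale)" for a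
  have "(\<Sum>a\<in>V. \<bar>y a\<bar>) = (\<Sum>a\<in>V - {b}. \<bar>x a\<bar> / scale)"
    using scale finite_complex_finite[OF complex] b_in_V by (simp add: sum.remove y_def)
  also have "\<dots> = 1" using sum scale by (simp flip: sum_divide_distrib)
  finally have "(\<Sum>a\<in>V. \<bar>y a\<bar>) = 1" .
  moreover have "{a. a \<notin> T \<and> y a \<noteq> 0} = {a. a \<notin> insert b T \<and> x a \<noteq> 0}"
    using scale by (auto simp: y_def)
  ultimately have y: "y \<in> signed_join V T L"
    using x scale by (auto simp: signed_join_def y_def)
  define t where "t = (1 - x b) / 2"
  then have t: "2 * t - 1 = - x b" "1 - 2 * t = x b" by (simp_all add: field_simps)
  have "x = susp_join b y t"
    using scale by (auto simp: susp_join_def t y_def axis_point_def fun_eq_iff simp flip: scale_def)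
  moreover have "0 < t" "t < 1" using scale by (auto simp: t_def scale_def)
  ultimately show ?thesis using y by (intro meridian)
qed

lemma suspension_coordinates_image:
  assumes \<theta>: "\<theta> ` topspace Y = signed_join V T L"
  shows "suspension_coordinates b \<theta> ` topspace (suspension Y) = signed_join V (insert b T) L"
proof (intro equalityI subsetI)
  fix x assume x: "x \<in> suspension_coordinates b \<theta> ` topspace (suspension Y)"
  have "axis_point b c \<in> signed_join V (insert b T) L" if "\<bar>c\<bar> = 1" for c
    using b_in_V that finite_complex_finite[OF complex] finite_complex_empty[OF complex]
    by (intro axis_point_in_signed_join) auto
  moreover have "susp_join b (\<theta> y) t \<in> signed_join V (insert b T) L"
    if "y \<in> topspace Y" "0 < t" "t < 1" for y t
    using that \<theta> by (intro susp_join_in_signed_join) auto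
  ultimately show "x \<in> signed_join V (insert b T) L"
    using x by (auto simp: topspace_suspension_eq)
next
  fix x assume "x \<in> signed_join V (insert b T) L"
  then show "x \<in> suspension_coordinates b \<theta> ` topspace (suspension Y)"
  proof (cases rule: signed_join_insert_cases)
    case pole
    then have "x = suspension_coordinates b \<theta> South \<or> x = suspension_coordinates b \<theta> North" by simp
    then show ?thesis unfolding topspace_suspension_eq by blast
  next
    case (meridian y t)
    then obtain z where z: "z \<in> topspace Y" "y = \<theta> z" using \<theta> by blast
    then have "x = suspension_coordinates b \<theta> (Meridian z t)" using meridian(4) by simp
    then show ?thesis using z(1) meridian(2,3) unfolding topspace_suspension_eq by blast
  qed
qed

lemma inj_on_suspension_coordinates:
  assumes inj: "inj_on \<theta> (topspace Y)" and \<theta>: "\<theta> ` topspace Y \<subseteq> signed_join V T L"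
  shows "inj_on (suspension_coordinates b \<theta>) (topspace (suspension Y))"
proof (rule inj_onI)
  fix p q assume pq: "p \<in> topspace (suspension Y)" "q \<in> topspace (suspension Y)"
    and eq: "suspension_coordinates b \<theta> p = suspension_coordinates b \<theta> q"
  have \<theta>_in: "\<theta> y \<in> signed_join V T L" if "y \<in> topspace Y" for y using \<theta> that by blast
  have at_b: "suspension_coordinates b \<theta> p b = suspension_coordinates b \<theta> q b" using eq by simp
  from pq consider (poles) "p \<in> {North, South}" "q \<in> {North, South}"
    | (left_pole) y t where "p \<in> {North, South}" "q = Meridian y t"
        "y \<in> topspace Y" "0 < t" "t < 1"
    | (right_pole) y t where "q \<in> {North, South}" "p = Meridian y t"
        "y \<in> topspace Y" "0 < t" "t < 1"
    | (meridians) y t z u where "p = Meridian y t" "q = Meridian z u"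
        "y \<in> topspace Y" "z \<in> topspace Y" "0 < t" "t < 1"
    unfolding topspace_suspension_eq by blast
  then show "p = q"
  proof cases
    case meridians
    then have "susp_join b (\<theta> y) t = susp_join b (\<theta> z) u" using eq by simp
    then have "\<theta> y = \<theta> z \<and> t = u"
      using susp_join_inject[OF \<theta>_in \<theta>_in] meridians(3-6) by blast
    then show ?thesis using meridians inj_onD[OF inj] by blast
  qed (use at_b susp_join_apex \<theta>_in in auto)
qed

lemma homeomorphic_map_suspension_coordinates:
  assumes "homeomorphic_map Y (top_of_set (signed_join V T L)) \<theta>"
  shows "homeomorphic_map (suspension Y) (top_of_set (signed_join V (insert b T) L))
      (suspension_coordinates b \<theta>)"
proof (rule continuous_imp_homeomorphic_map)
  have onto: "\<theta> ` topspace Y = signed_join V T L" and inj: "inj_on \<theta> (topspace Y)"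
    and cont: "continuous_map Y (top_of_set (signed_join V T L)) \<theta>"
    using assms by (auto simp: homeomorphic_eq_everything_map)
  show "compact_space (suspension Y)"
    using complex assms by (intro compact_space_suspension compact_space_homeomorphic_signed_join)
  show image: "suspension_coordinates b \<theta> ` topspace (suspension Y) =
      topspace (top_of_set (signed_join V (insert b T) L))"
    using suspension_coordinates_image[OF onto] by simp
  have "continuous_map (suspension Y) euclidean (suspension_coordinates b \<theta>)"
    using cont by (intro continuous_map_suspension_coordinates)
      (rule continuous_map_into_fulltopology)
  then show "continuous_map (suspension Y) (top_of_set (signed_join V (insert b T) L))
      (suspension_coordinates b \<theta>)"
    using image by (intro continuous_map_into_subtopology) auto
  show "inj_on (suspension_coordinates b \<theta>) (topspace (suspension Y))"
    using inj onto by (intro inj_on_suspension_coordinates) simp_all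
qed (rule Hausdorff_space_top_of_set_fun)

end

primrec octahedral_coordinates :: "(nat \<Rightarrow> 'a) \<Rightarrow> nat \<Rightarrow> ('a \<Rightarrow> real) susp_point \<Rightarrow> 'a \<Rightarrow> real" where
  "octahedral_coordinates s 0 = (\<lambda>p. case p of Base x \<Rightarrow> x | _ \<Rightarrow> undefined)"
| "octahedral_coordinates s (Suc n) = suspension_coordinates (s n) (octahedral_coordinates s n)"

lemma octahedral_coordinates_North:
  "1 \<le> r \<Longrightarrow> octahedral_coordinates s r North = axis_point (s (r - 1)) (- 1)"
  by (cases r) auto

lemma homeomorphic_map_octahedral_coordinates:
  assumes L: "finite_complex V L"
    and s: "inj_on s {..<r}" "s ` {..<r} \<subseteq> V" "\<Union>L \<inter> s ` {..<r} = {}"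
  shows "homeomorphic_map (iterated_suspension r (realization L))
    (top_of_set (signed_join V (s ` {..<r}) L)) (octahedral_coordinates s r)"
  using s
proof (induction r)
  case 0
  obtain g where "homeomorphic_maps (realization L) (base_copy (realization L)) Base g"
    using homeomorphic_map_base_copy homeomorphic_map_maps by blast
  then have g: "homeomorphic_map (base_copy (realization L)) (realization L) g"
    and g_Base: "\<And>x. x \<in> topspace (realization L) \<Longrightarrow> g (Base x) = x"
    by (simp_all add: homeomorphic_maps_map)
  have "topspace (base_copy (realization L)) = Base ` topspace (realization L)"
    using homeomorphic_imp_surjective_map[OF homeomorphic_map_base_copy] by blast
  then have "homeomorphic_map (base_copy (realization L)) (realization L)
      (octahedral_coordinates s 0)"
    using g_Base by (intro homeomorphic_map_eq[OF g]) auto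
  then show ?case
    using realization_eq_signed_join[OF L] by (simp add: iterated_suspension_def)
next
  case (Suc r)
  have "inj_on s {..<r}" "s ` {..<r} \<subseteq> V" "\<Union>L \<inter> s ` {..<r} = {}"
    and apex: "s r \<in> V" "s r \<notin> s ` {..<r}" "s r \<notin> \<Union>L"
    using Suc.prems by (auto simp: lessThan_Suc)
  then have "homeomorphic_map (iterated_suspension r (realization L))
      (top_of_set (signed_join V (s ` {..<r}) L)) (octahedral_coordinates s r)"
    by (intro Suc.IH)
  from homeomorphic_map_suspension_coordinates[OF L apex this] show ?case
    by (simp add: iterated_suspension_def lessThan_Suc)
qed

section \<open>Pushing points out of open facets\<close>

definition normalise :: "'a set \<Rightarrow> ('a \<Rightarrow> real) \<Rightarrow> 'a \<Rightarrow> real" where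
  "normalise V y a = y a / (\<Sum>b\<in>V. \<bar>y b\<bar>)"

lemma normalise_id: "(\<Sum>b\<in>V. \<bar>y b\<bar>) = 1 \<Longrightarrow> normalise V y = y"
  by (simp add: normalise_def fun_eq_iff)

lemma normalise_nonpos: "y a \<le> 0 \<Longrightarrow> normalise V y a \<le> 0"
  by (simp add: normalise_def divide_nonpos_nonneg sum_nonneg)

lemma normalise_in_signed_join:
  assumes "0 < (\<Sum>b\<in>V. \<bar>y b\<bar>)" "\<And>a. a \<notin> V \<Longrightarrow> y a = 0" "\<And>a. a \<notin> T \<Longrightarrow> 0 \<le> y a"
    and "{a. a \<notin> T \<and> y a \<noteq> 0} \<in> L"
  shows "normalise V y \<in> signed_join V T L"
proof -
  have "{a. a \<notin> T \<and> normalise V y a \<noteq> 0} = {a. a \<notin> T \<and> y a \<noteq> 0}"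
    using assms(1) by (auto simp: normalise_def)
  moreover have "(\<Sum>a\<in>V. \<bar>normalise V y a\<bar>) = 1"
    using assms(1) by (simp add: normalise_def flip: sum_divide_distrib)
  ultimately show ?thesis
    using assms by (auto simp: signed_join_def normalise_def)
qed

lemma continuous_on_normalise:
  assumes "\<And>a. continuous_on X (\<lambda>p. f p a)" "\<And>p. p \<in> X \<Longrightarrow> 0 < (\<Sum>b\<in>V. \<bar>f p b\<bar>)"
  shows "continuous_on X (\<lambda>p. normalise V (f p))"
  unfolding normalise_def
  by (intro continuous_on_coordinatewise_then_product continuous_intros assms(1))
    (use assms(2) in force)

definition depth :: "'a set \<Rightarrow> ('a \<Rightarrow> real) \<Rightarrow> real" where
  "depth S x = max 0 (Min (x ` S))"

lemma depth_nonneg: "0 \<le> depth S x"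
  by (simp add: depth_def)

lemma depth_le: "\<lbrakk>finite S; s \<in> S; 0 < depth S x\<rbrakk> \<Longrightarrow> depth S x \<le> x s"
  by (auto simp: depth_def max_def split: if_splits)

lemma depth_attained:
  assumes "finite S" "S \<noteq> {}"
  obtains s where "s \<in> S" "x s \<le> depth S x"
proof -
  have "Min (x ` S) \<in> x ` S" using assms by simp
  then show ?thesis using that by (auto simp: depth_def)
qed

lemma depth_eq_0_iff:
  assumes "finite S" "S \<noteq> {}"
  shows "depth S x = 0 \<longleftrightarrow> (\<exists>s\<in>S. x s \<le> 0)"
proof -
  have "depth S x = 0 \<longleftrightarrow> Min (x ` S) \<le> 0" by (auto simp: depth_def max_def)
  then show ?thesis using assms by (simp add: Min_le_iff)
qed

lemma continuous_on_Min:
  fixes f :: "'b::topological_space \<Rightarrow> 'a \<Rightarrow> 'c::linorder_topology"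
  assumes "finite S" "S \<noteq> {}" "\<And>s. s \<in> S \<Longrightarrow> continuous_on X (\<lambda>p. f p s)"
  shows "continuous_on X (\<lambda>p. Min (f p ` S))"
  using assms
proof (induction S rule: finite_ne_induct)
  case (singleton s)
  then show ?case by simp
next
  case (insert s S)
  have "continuous_on X (\<lambda>p. min (f p s) (Min (f p ` S)))"
    using insert by (intro continuous_on_min) auto
  then show ?case using insert by simp
qed

lemma continuous_on_depth:
  assumes "finite S" "S \<noteq> {}" "\<And>s. s \<in> S \<Longrightarrow> continuous_on X (\<lambda>p. f p s)"
  shows "continuous_on X (\<lambda>p. depth S (f p))"
  unfolding depth_def using assms by (intro continuous_on_max continuous_on_const continuous_on_Min)

definition total_depth :: "'a set set \<Rightarrow> ('a \<Rightarrow> real) \<Rightarrow> real" where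
  "total_depth \<S> x = (\<Sum>S\<in>\<S>. depth S x)"

lemma total_depth_singleton [simp]: "total_depth {S} x = depth S x"
  by (simp add: total_depth_def)

definition boundary_points :: "'a set set \<Rightarrow> ('a \<Rightarrow> real) set \<Rightarrow> ('a \<Rightarrow> real) set" where
  "boundary_points \<S> X = {x \<in> X. total_depth \<S> x = 0}"

lemma boundary_points_subset: "boundary_points \<S> X \<subseteq> X"
  by (auto simp: boundary_points_def)

definition shave :: "'a set set \<Rightarrow> nat \<Rightarrow> real \<Rightarrow> ('a \<Rightarrow> real) \<Rightarrow> 'a \<Rightarrow> real" where
  "shave \<S> r t x = (\<lambda>a. x a - (\<Sum>S | S \<in> \<S> \<and> a \<in> S. min (depth S x) (t / (2 * real r))))"

definition collapse :: "'a set set \<Rightarrow> ('a \<Rightarrow> real) \<Rightarrow> 'a \<Rightarrow> real" where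
  "collapse \<S> x = (\<lambda>a. total_depth \<S> x * x a)"

locale exclusive_facets =
  fixes V T :: "'a set" and L :: "'a set set" and \<S> :: "'a set set" and r :: nat
  assumes complex: "finite_complex V L" and finite_facets: "finite \<S>" and r_pos: "1 \<le> r"
    and facet_subset: "\<And>S. S \<in> \<S> \<Longrightarrow> S \<subseteq> V"
    and card_facet: "\<And>S. S \<in> \<S> \<Longrightarrow> card S = r"
    and exclusive: "\<And>x S S'. \<lbrakk>x \<in> signed_join V T L; S \<in> \<S>; S' \<in> \<S>;
      0 < depth S x; 0 < depth S' x\<rbrakk> \<Longrightarrow> S = S'"
begin

abbreviation "points \<equiv> signed_join V T L"

lemma finite_V: "finite V"
  using complex by (rule finite_complex_finite)

lemma finite_facet: "S \<in> \<S> \<Longrightarrow> finite S"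
  using facet_subset finite_V by (rule finite_subset)

lemma facet_nonempty: "S \<in> \<S> \<Longrightarrow> S \<noteq> {}"
  using card_facet r_pos by fastforce

lemma depth_facet_eq_0_iff: "S \<in> \<S> \<Longrightarrow> depth S x = 0 \<longleftrightarrow> (\<exists>s\<in>S. x s \<le> 0)"
  by (intro depth_eq_0_iff finite_facet facet_nonempty)

lemma total_depth_nonneg: "0 \<le> total_depth \<S> x"
  by (simp add: total_depth_def sum_nonneg depth_nonneg)

lemma total_depth_eq_0_iff: "total_depth \<S> x = 0 \<longleftrightarrow> (\<forall>S\<in>\<S>. depth S x = 0)"
  unfolding total_depth_def using finite_facets
  by (subst sum_nonneg_eq_0_iff) (auto simp: depth_nonneg)

lemma boundary_points_iff: "x \<in> boundary_points \<S> points \<longleftrightarrow> x \<in> points \<and> (\<forall>S\<in>\<S>. \<exists>s\<in>S. x s \<le> 0)"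
  by (simp add: boundary_points_def total_depth_eq_0_iff depth_facet_eq_0_iff)

lemma total_depth_nonzeroE:
  assumes "total_depth \<S> x \<noteq> 0"
  obtains S where "S \<in> \<S>" "0 < depth S x"
  using assms depth_nonneg by (auto simp: total_depth_eq_0_iff less_le)

lemma depth_eq_0_other:
  assumes "x \<in> points" "S \<in> \<S>" "0 < depth S x" "S' \<in> \<S>" "S' \<noteq> S"
  shows "depth S' x = 0"
  using exclusive[OF assms(1,2,4,3)] assms(5) depth_nonneg[of S' x] by force

lemma total_depth_eq:
  assumes "x \<in> points" "S \<in> \<S>" "0 < depth S x"
  shows "total_depth \<S> x = depth S x"
proof -
  have "total_depth \<S> x = (\<Sum>S'\<in>{S}. depth S' x)"
    unfolding total_depth_def using assms finite_facets depth_eq_0_other[OF assms]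
    by (intro sum.mono_neutral_right) auto
  then show ?thesis by simp
qed

lemma continuous_on_total_depth:
  assumes "\<And>a. continuous_on X (\<lambda>p. f p a)"
  shows "continuous_on X (\<lambda>p. total_depth \<S> (f p))"
  unfolding total_depth_def
  by (intro continuous_intros continuous_on_depth finite_facet facet_nonempty assms)

lemma shave_le: "0 \<le> t \<Longrightarrow> shave \<S> r t x a \<le> x a"
  by (simp add: shave_def sum_nonneg depth_nonneg)

lemma shave_boundary_point:
  assumes "total_depth \<S> x = 0" "0 \<le> t"
  shows "shave \<S> r t x = x"
  using assms by (auto simp: shave_def total_depth_eq_0_iff fun_eq_iff)

lemma shave_eq:
  assumes "x \<in> points" "S \<in> \<S>" "0 < depth S x" "0 \<le> t"
  shows "shave \<S> r t x a = x a - (if a \<in> S then min (depth S x) (t / (2 * real r)) else 0)"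
proof -
  have "(\<Sum>S' | S' \<in> \<S> \<and> a \<in> S'. min (depth S' x) (t / (2 * real r))) =
      (\<Sum>S' | S' \<in> \<S> \<and> a \<in> S'. if S' = S then min (depth S x) (t / (2 * real r)) else 0)"
    using depth_eq_0_other[OF assms(1-3)] assms(4) by (intro sum.cong) auto
  also have "\<dots> = (if a \<in> S then min (depth S x) (t / (2 * real r)) else 0)"
    using assms(2) finite_facets by simp
  finally show ?thesis by (simp add: shave_def)
qed

lemma shave_cases:
  assumes "x \<in> points" "0 \<le> t"
  obtains (boundary) "shave \<S> r t x = x"
  | (interior) S d where "S \<in> \<S>" "0 \<le> d" "d \<le> t / (2 * real r)" "\<And>s. s \<in> S \<Longrightarrow> d \<le> x s \<and> x s \<noteq> 0"
      "\<And>a. shave \<S> r t x a = x a - (if a \<in> S then d else 0)"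
proof (cases "total_depth \<S> x = 0")
  case True
  then show ?thesis using shave_boundary_point assms(2) by (intro boundary)
next
  case False
  then obtain S where S: "S \<in> \<S>" "0 < depth S x" by (rule total_depth_nonzeroE)
  show ?thesis
  proof (rule interior[OF S(1)])
    show "0 \<le> min (depth S x) (t / (2 * real r))" using S(2) assms(2) by simp
    show "min (depth S x) (t / (2 * real r)) \<le> x s \<and> x s \<noteq> 0" if "s \<in> S" for s
      using depth_le[OF finite_facet[OF S(1)] that S(2)] S(2) by auto
  qed (use shave_eq[OF assms(1) S assms(2)] in simp_all)
qed

lemma sum_abs_shave_pos:
  assumes x: "x \<in> points" and t: "t \<in> {0..1}"
  shows "0 < (\<Sum>a\<in>V. \<bar>shave \<S> r t x a\<bar>)"
proof -
  have "0 \<le> t" using t by simp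
  with x show ?thesis
  proof (cases rule: shave_cases)
    case boundary
    then show ?thesis using signed_join_sum[OF x] by simp
  next
    case (interior S d)
    have "real r * d \<le> real r * (t / (2 * real r))"
      using interior(3) by (intro mult_left_mono) auto
    also have "\<dots> = t / 2" using r_pos by simp
    finally have "real r * d \<le> 1 / 2" using t by simp
    moreover have "(\<Sum>a\<in>V. if a \<in> S then d else 0) = real r * d"
      using finite_V facet_subset[OF interior(1)] card_facet[OF interior(1)]
      by (simp add: sum.If_cases Int_absorb1)
    moreover have "(\<Sum>a\<in>V. \<bar>x a\<bar> - (if a \<in> S then d else 0)) \<le> (\<Sum>a\<in>V. \<bar>shave \<S> r t x a\<bar>)"
      using interior(2) by (intro sum_mono) (auto simp: interior(5))
    ultimately show ?thesis using signed_join_sum[OF x] by (simp add: sum_subtractf)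
  qed
qed

lemma normalise_shave_in:
  assumes x: "x \<in> points" and t: "t \<in> {0..1}"
  shows "normalise V (shave \<S> r t x) \<in> points"
proof (rule normalise_in_signed_join[OF sum_abs_shave_pos[OF assms]])
  have "0 \<le> t" using t by simp
  with x have shave: "(a \<notin> V \<longrightarrow> shave \<S> r t x a = 0) \<and> (a \<notin> T \<longrightarrow> 0 \<le> shave \<S> r t x a) \<and>
      (a \<notin> T \<and> shave \<S> r t x a \<noteq> 0 \<longrightarrow> x a \<noteq> 0)" for a
  proof (cases rule: shave_cases)
    case boundary
    then show ?thesis using x by (auto simp: signed_join_def)
  next
    case (interior S d)
    then show ?thesis using x facet_subset[OF interior(1)] by (auto simp: signed_join_def)
  qed
  then show "shave \<S> r t x a = 0" if "a \<notin> V" for a using that by blast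
  show "0 \<le> shave \<S> r t x a" if "a \<notin> T" for a using that shave by blast
  show "{a. a \<notin> T \<and> shave \<S> r t x a \<noteq> 0} \<in> L"
    by (rule finite_complex_downward[OF complex signed_join_face[OF x]]) (use shave in blast)
qed

lemma total_depth_normalise_shave:
  assumes x: "x \<in> points" and t: "0 \<le> t" "2 * real r * total_depth \<S> x \<le> t"
  shows "total_depth \<S> (normalise V (shave \<S> r t x)) = 0"
proof -
  have "\<exists>s\<in>S. shave \<S> r t x s \<le> 0" if S: "S \<in> \<S>" for S
  proof (cases "depth S x = 0")
    case True
    then show ?thesis
      using depth_facet_eq_0_iff[OF S] shave_le[OF t(1)] by (meson order_trans)
  next
    case False
    then have pos: "0 < depth S x" using depth_nonneg[of S x] by simp
    then have "depth S x \<le> t / (2 * real r)"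
      using t(2) r_pos by (simp add: total_depth_eq[OF x S] field_simps)
    moreover obtain s where "s \<in> S" "x s \<le> depth S x"
      using depth_attained[OF finite_facet[OF S] facet_nonempty[OF S]] .
    ultimately show ?thesis by (auto simp: shave_eq[OF x S pos t(1)] min_absorb1)
  qed
  then show ?thesis
    using normalise_nonpos by (fastforce simp: total_depth_eq_0_iff depth_facet_eq_0_iff)
qed

lemma continuous_on_normalise_shave:
  "continuous_on ({0..1} \<times> points) (\<lambda>q. normalise V (shave \<S> r (fst q) (snd q)))"
proof (rule continuous_on_normalise)
  show "continuous_on ({0..1} \<times> points) (\<lambda>q. shave \<S> r (fst q) (snd q) a)" for a
    unfolding shave_def using r_pos
    by (intro continuous_intros continuous_on_min continuous_on_depth continuous_on_snd_coordinate)
      (auto simp: finite_facet facet_nonempty)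
qed (use sum_abs_shave_pos in auto)

lemma shrinkable_boundary_points:
  assumes "shrinkable (top_of_set (boundary_points \<S> points)) (boundary_points \<S> points) p"
  shows "shrinkable (top_of_set points) (boundary_points \<S> points) p"
proof (rule shrinkable_zero_set)
  let ?time = "\<lambda>x. 2 * real r * total_depth \<S> x"
  show "boundary_points \<S> points = {x \<in> topspace (top_of_set points). ?time x = 0}"
    using r_pos by (auto simp: boundary_points_def)
  show "continuous_map (top_of_set points) euclideanreal ?time"
    by (simp add: continuous_on_mult continuous_on_total_depth continuous_on_coordinate)
  show "0 \<le> ?time x" for x by (simp add: total_depth_nonneg)
  show "continuous_map (prod_topology unit_interval (top_of_set points)) (top_of_set points)
      (\<lambda>q. normalise V (shave \<S> r (fst q) (snd q)))"
    using continuous_on_normalise_shave normalise_shave_in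
    by (auto simp: continuous_map_in_subtopology)
  show "normalise V (shave \<S> r (fst (0, x)) (snd (0, x))) = x"
    if "x \<in> topspace (top_of_set points)" for x
  proof -
    have "shave \<S> r 0 x = x" by (simp add: shave_def depth_nonneg min_absorb2)
    then show ?thesis using that by (simp add: normalise_id signed_join_sum)
  qed
  show "?time (normalise V (shave \<S> r (fst (t, x)) (snd (t, x)))) = 0"
    if "t \<in> {0..1}" "x \<in> topspace (top_of_set points)" "?time x \<le> t" for t x
    using total_depth_normalise_shave that by simp
  show "shrinkable (subtopology (top_of_set points) (boundary_points \<S> points))
      (boundary_points \<S> points) p"
    using assms boundary_points_subset[of \<S> points]
    by (simp add: subtopology_subtopology Int_absorb1)
qed

lemma sum_abs_collapse: "x \<in> points \<Longrightarrow> (\<Sum>a\<in>V. \<bar>collapse \<S> x a\<bar>) = total_depth \<S> x"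
  using total_depth_nonneg[of x]
  by (simp add: collapse_def abs_mult signed_join_sum flip: sum_distrib_left)

lemma collapse_eq_0_iff:
  assumes "x \<in> points"
  shows "collapse \<S> x = (\<lambda>_. 0) \<longleftrightarrow> x \<in> boundary_points \<S> points"
proof
  assume "collapse \<S> x = (\<lambda>_. 0)"
  then show "x \<in> boundary_points \<S> points"
    using sum_abs_collapse[OF assms] assms by (simp add: boundary_points_def)
qed (simp add: collapse_def boundary_points_def)

lemma collapse_eq_iff:
  assumes "x \<in> points" "y \<in> points"
  shows "collapse \<S> x = collapse \<S> y \<longleftrightarrow>
    x = y \<or> x \<in> boundary_points \<S> points \<and> y \<in> boundary_points \<S> points"
proof
  assume eq: "collapse \<S> x = collapse \<S> y"
  then have "total_depth \<S> x = total_depth \<S> y"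
    using sum_abs_collapse[OF assms(1)] sum_abs_collapse[OF assms(2)] by simp
  then show "x = y \<or> x \<in> boundary_points \<S> points \<and> y \<in> boundary_points \<S> points"
    using fun_cong[OF eq] assms by (auto simp: collapse_def boundary_points_def fun_eq_iff)
qed (auto simp: collapse_def boundary_points_def)

lemma continuous_on_collapse: "continuous_on points (collapse \<S>)"
  unfolding collapse_def
  by (intro continuous_on_coordinatewise_then_product continuous_intros continuous_on_total_depth
      continuous_on_coordinate)

lemma quotient_map_collapse:
  "quotient_map (top_of_set points) (top_of_set (collapse \<S> ` points)) (collapse \<S>)"
  using continuous_on_collapse compact_signed_join[OF complex]
  by (intro continuous_imp_quotient_map Hausdorff_space_top_of_set_fun)
    (auto simp: continuous_map_in_subtopology compact_space_subtopology)

end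

section \<open>Contracting the complement of an open facet\<close>

text \<open>
  Moving towards \<open>-p\<close> in a straight line would run through the origin at the vertex \<open>p\<close>; the term
  with \<open>max 0 (x p)\<close> avoids this by first making the coordinates in \<open>S\<close> smaller.
\<close>

definition vertex_contraction :: "'a set \<Rightarrow> 'a \<Rightarrow> real \<Rightarrow> ('a \<Rightarrow> real) \<Rightarrow> 'a \<Rightarrow> real" where
  "vertex_contraction S p t x =
    (\<lambda>a. (1 - t) * (x a - (if a \<in> S then t * max 0 (x p) else 0)) - axis_point p t a)"

lemma vertex_contraction_0: "vertex_contraction S p 0 x = x"
  by (auto simp: vertex_contraction_def axis_point_def)

lemma vertex_contraction_1: "vertex_contraction S p 1 x = axis_point p (- 1)"
  by (auto simp: vertex_contraction_def axis_point_def)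

lemma vertex_contraction_outside: "\<lbrakk>p \<in> S; a \<notin> S\<rbrakk> \<Longrightarrow> vertex_contraction S p t x a = (1 - t) * x a"
  by (auto simp: vertex_contraction_def axis_point_def)

lemma vertex_contraction_nonpos:
  assumes "s \<in> S" "x s \<le> 0" "t \<in> {0..1}"
  shows "vertex_contraction S p t x s \<le> 0"
proof -
  have axis_nonneg: "0 \<le> axis_point p t s" and "0 \<le> t * max 0 (x p)"
    using assms(3) by (auto simp: axis_point_def)
  then have "x s - t * max 0 (x p) \<le> 0" using assms(2) by linarith
  then have "(1 - t) * (x s - t * max 0 (x p)) \<le> 0"
    using assms(3) by (intro mult_nonneg_nonpos) auto
  then show ?thesis using assms(1) axis_nonneg by (simp add: vertex_contraction_def)
qed

lemma vertex_contraction_nonzero: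
  assumes "p \<in> S" "s \<in> S" "x s \<le> 0" "0 < t" "t < 1"
  shows "vertex_contraction S p t x s \<noteq> 0 \<or> vertex_contraction S p t x p \<noteq> 0"
proof (rule ccontr)
  assume "\<not> ?thesis"
  then have zero: "vertex_contraction S p t x s = 0" "vertex_contraction S p t x p = 0"
    by simp_all
  then have "(1 - t) * (x s - t * max 0 (x p)) = axis_point p t s"
    using assms(2) by (simp add: vertex_contraction_def)
  also have "\<dots> \<ge> 0" using assms(4) by (simp add: axis_point_def)
  finally have "t * max 0 (x p) \<le> 0"
    using assms(3,5) by (simp add: zero_le_mult_iff)
  then have "x p \<le> 0" using assms(4) by (simp add: mult_le_0_iff)
  then have "(1 - t) * x p \<le> 0" using assms(5) by (simp add: mult_nonneg_nonpos)
  then show False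
    using zero(2) assms(1,4) \<open>x p \<le> 0\<close> by (simp add: vertex_contraction_def)
qed

context
  fixes V S :: "'a set" and L :: "'a set set" and p :: 'a
  assumes complex: "finite_complex V L" and S_subset: "S \<subseteq> V" and p_in: "p \<in> S"
begin

lemma exclusive_facets_singleton: "exclusive_facets V S L {S} (card S)"
proof
  have "finite S" using S_subset finite_complex_finite[OF complex] by (rule finite_subset)
  then show "1 \<le> card S" using p_in by (auto simp: Suc_le_eq card_gt_0_iff)
qed (use complex S_subset in auto)

interpretation exclusive_facets V S L "{S}" "card S"
  by (rule exclusive_facets_singleton)

lemma sum_abs_vertex_contraction_pos:
  assumes x: "x \<in> boundary_points {S} points" and t: "t \<in> {0..1}"
  shows "0 < (\<Sum>a\<in>V. \<bar>vertex_contraction S p t x a\<bar>)"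
proof -
  have pos: ?thesis if "a \<in> V" "vertex_contraction S p t x a \<noteq> 0" for a
    using that finite_V by (intro sum_pos2[of _ a]) auto
  have "p \<in> V" using p_in S_subset by blast
  consider (start) "t = 0" | (stop) "t = 1" | (between) "0 < t" "t < 1" using t by fastforce
  then show ?thesis
  proof cases
    case start
    then show ?thesis
      using signed_join_sum[OF subsetD[OF boundary_points_subset x]]
      by (simp add: vertex_contraction_0)
  next
    case stop
    then show ?thesis using pos[OF \<open>p \<in> V\<close>] by (simp add: vertex_contraction_def)
  next
    case between
    obtain s where "s \<in> S" "x s \<le> 0" using x boundary_points_iff by blast
    then show ?thesis
      using vertex_contraction_nonzero[of p S s x t] p_in between pos \<open>p \<in> V\<close> S_subset by blast
  qed
qed

lemma normalise_vertex_contraction_in: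
  assumes x: "x \<in> boundary_points {S} points" and t: "t \<in> {0..1}"
  shows "normalise V (vertex_contraction S p t x) \<in> boundary_points {S} points"
proof -
  have x_points: "x \<in> points" using x boundary_points_subset by blast
  note outside = vertex_contraction_outside[OF p_in]
  have "normalise V (vertex_contraction S p t x) \<in> points"
  proof (rule normalise_in_signed_join[OF sum_abs_vertex_contraction_pos[OF assms]])
    show "vertex_contraction S p t x a = 0" if "a \<notin> V" for a
      using that S_subset outside[of a t x] signed_join_outside[OF x_points that] by auto
    show "0 \<le> vertex_contraction S p t x a" if "a \<notin> S" for a
      using that outside t signed_join_nonneg[OF x_points] by simp
    show "{a. a \<notin> S \<and> vertex_contraction S p t x a \<noteq> 0} \<in> L"
      by (rule finite_complex_downward[OF complex signed_join_face[OF x_points]])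
        (auto simp: outside)
  qed
  moreover obtain s where s: "s \<in> S" "x s \<le> 0" using x boundary_points_iff by blast
  moreover have "normalise V (vertex_contraction S p t x) s \<le> 0"
    using vertex_contraction_nonpos[of s S x] s t by (intro normalise_nonpos) blast
  ultimately show ?thesis
    unfolding boundary_points_iff by blast
qed

lemma continuous_on_normalise_vertex_contraction:
  "continuous_on ({0..1} \<times> boundary_points {S} points)
    (\<lambda>q. normalise V (vertex_contraction S p (fst q) (snd q)))"
proof (rule continuous_on_normalise)
  let ?D = "{0..1::real} \<times> boundary_points {S} points"
  have "continuous_on ?D (\<lambda>q. if a \<in> S then fst q * max 0 (snd q p) else 0)" for a
    by (cases "a \<in> S")
      (auto intro!: continuous_intros continuous_on_max continuous_on_snd_coordinate)
  moreover have "continuous_on ?D (\<lambda>q. axis_point p (fst q) a)" for a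
    by (cases "a = p") (auto intro!: continuous_intros)
  ultimately show "continuous_on ?D (\<lambda>q. vertex_contraction S p (fst q) (snd q) a)" for a
    unfolding vertex_contraction_def by (intro continuous_intros continuous_on_snd_coordinate)
qed (use sum_abs_vertex_contraction_pos in auto)

lemma shrinkable_octahedral_boundary:
  "shrinkable (top_of_set points) (boundary_points {S} points) (axis_point p (- 1))"
proof (rule shrinkable_boundary_points)
  let ?A = "boundary_points {S} points" and ?p = "axis_point p (- 1)"
  let ?h = "\<lambda>q. normalise V (vertex_contraction S p (fst q) (snd q))"
  have "p \<in> V" using p_in S_subset by blast
  then have "?p \<in> points"
    using p_in finite_V finite_complex_empty[OF complex] by (intro axis_point_in_signed_join) auto
  then have p: "?p \<in> ?A"
    unfolding boundary_points_iff using p_in by (auto intro!: bexI[of _ p])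
  have norm_p: "normalise V ?p = ?p"
    by (rule normalise_id) (simp add: sum_abs_axis_point[OF finite_V \<open>p \<in> V\<close>])
  have "continuous_map (prod_topology unit_interval (top_of_set ?A)) (top_of_set ?A) ?h"
    using continuous_on_normalise_vertex_contraction normalise_vertex_contraction_in
    by (auto simp: continuous_map_in_subtopology)
  moreover have "normalise V x = x" if "x \<in> ?A" for x
    using signed_join_sum[OF subsetD[OF boundary_points_subset that]] by (rule normalise_id)
  moreover have "vertex_contraction S p t ?p = ?p" for t
    by (auto simp: vertex_contraction_def axis_point_def fun_eq_iff)
  ultimately have "shrinking_homotopy (top_of_set ?A) ?A ?p ?h"
    using normalise_vertex_contraction_in
    by (simp add: shrinking_homotopy_def norm_p vertex_contraction_0 vertex_contraction_1)
  then show "shrinkable (top_of_set ?A) ?A ?p" using p by (auto simp: shrinkable_def)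
qed

end

section \<open>Connected induced subgraphs\<close>

lemma arc_mono_connected: "arc_mono connected_graph"
  unfolding arc_mono_def
proof (intro allI impI, elim conjE)
  fix H1 H2 :: "('a, 'b) pre_digraph"
  assume H: "connected_graph H1" "subgraph H1 H2" "verts H1 = verts H2"
  then have "wf_digraph H2" "spanning H1 H2" by (simp_all add: subgraph_def spanning_def)
  then show "connected_graph H2" using H(1) by (rule wf_digraph.connected_spanning_imp_connected)
qed

lemma (in wf_digraph) strongly_connected_iff_cut:
  "strongly_connected G \<longleftrightarrow> verts G \<noteq> {} \<and>
    (\<forall>D. D \<noteq> {} \<and> D \<subset> verts G \<longrightarrow> (\<exists>x\<in>D. \<exists>y\<in>verts G - D. x \<rightarrow>\<^bsub>G\<^esub> y))"
    (is "_ \<longleftrightarrow> _ \<and> ?cut")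
proof (intro iffI conjI allI impI)
  assume conn: "strongly_connected G"
  then show "verts G \<noteq> {}" by (simp add: strongly_connected_def)
  fix D assume D: "D \<noteq> {} \<and> D \<subset> verts G"
  then obtain u w where u: "u \<in> D" and w: "w \<in> verts G - D" by blast
  then have "u \<rightarrow>\<^sup>* w" using conn D by (auto simp: strongly_connected_def)
  then have "w \<notin> D \<longrightarrow> (\<exists>x\<in>D. \<exists>y\<in>verts G - D. x \<rightarrow>\<^bsub>G\<^esub> y)"
  proof (induction rule: reachable_induct)
    case base
    then show ?case using u by simp
  next
    case (step x y)
    then show ?case using adj_in_verts by blast
  qed
  then show "\<exists>x\<in>D. \<exists>y\<in>verts G - D. x \<rightarrow>\<^bsub>G\<^esub> y" using w by blast
next
  assume cut: "verts G \<noteq> {} \<and> ?cut"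
  have "{w. u \<rightarrow>\<^sup>* w} = verts G" if "u \<in> verts G" for u
  proof (rule ccontr)
    assume "{w. u \<rightarrow>\<^sup>* w} \<noteq> verts G"
    moreover have "{w. u \<rightarrow>\<^sup>* w} \<subseteq> verts G" by (auto dest: reachable_in_verts)
    moreover have "{w. u \<rightarrow>\<^sup>* w} \<noteq> {}" using that by auto
    ultimately obtain x y where "u \<rightarrow>\<^sup>* x" "\<not> u \<rightarrow>\<^sup>* y" "x \<rightarrow>\<^bsub>G\<^esub> y"
      using cut[THEN conjunct2, rule_format, of "{w. u \<rightarrow>\<^sup>* w}"] by blast
    then show False using reachable_adj_trans by blast
  qed
  then show "strongly_connected G" using cut by (auto simp: strongly_connected_def)
qed

lemma (in sym_digraph) connected_iff_strongly_connected:
  "connected_graph G \<longleftrightarrow> strongly_connected G"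
  by (simp add: connected_def strongly_connected_def reachable_mk_symmetric_eq[OF sym_arcs])

lemma dominates_induce_subgraph_iff:
  "x \<rightarrow>\<^bsub>G \<restriction> C\<^esub> y \<longleftrightarrow> x \<in> C \<and> y \<in> C \<and> x \<rightarrow>\<^bsub>G\<^esub> y"
  by (auto simp: arcs_ends_conv)

lemma induce_subgraph_induce_subgraph: "D \<subseteq> C \<Longrightarrow> (G \<restriction> C) \<restriction> D = G \<restriction> D"
  by (auto simp: induce_subgraph_def)

context graph
begin

lemma graph_induce_subgraph:
  assumes "C \<subseteq> verts G"
  shows "graph (G \<restriction> C)"
proof -
  have "induced_subgraph (G \<restriction> C) G" using assms by (rule induced_induce)
  then show ?thesis
    using induced_graph_imp_symmetric[OF sym_arcs] digraphI_induced digraph.graphI by blast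
qed

lemma connected_induce_subgraph_iff_cut:
  assumes "C \<subseteq> verts G"
  shows "connected_graph (G \<restriction> C) \<longleftrightarrow>
    C \<noteq> {} \<and> (\<forall>D. D \<noteq> {} \<and> D \<subset> C \<longrightarrow> (\<exists>x\<in>D. \<exists>y\<in>C - D. x \<rightarrow>\<^bsub>G\<^esub> y))"
proof -
  interpret C: graph "G \<restriction> C" using assms by (rule graph_induce_subgraph)
  show ?thesis
    unfolding C.connected_iff_strongly_connected C.strongly_connected_iff_cut
    by (auto simp: dominates_induce_subgraph_iff)
qed

lemma connected_induce_subgraph_cut:
  assumes conn: "connected_graph (G \<restriction> C)" and C: "C \<subseteq> verts G" and D: "C \<inter> D \<noteq> {}" "\<not> C \<subseteq> D"
  shows "\<exists>x\<in>C \<inter> D. \<exists>y\<in>C - D. x \<rightarrow>\<^bsub>G\<^esub> y"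
proof -
  have "C \<inter> D \<subset> C" using D(2) by blast
  then have "\<exists>x\<in>C \<inter> D. \<exists>y\<in>C - C \<inter> D. x \<rightarrow>\<^bsub>G\<^esub> y"
    using conn D(1) unfolding connected_induce_subgraph_iff_cut[OF C] by simp
  then show ?thesis by blast
qed

lemma connected_induce_subgraph_singleton: "x \<in> verts G \<Longrightarrow> connected_graph (G \<restriction> {x})"
  by (subst connected_induce_subgraph_iff_cut) auto

lemma connected_induce_subgraph_Un:
  assumes C: "connected_graph (G \<restriction> C)" "C \<subseteq> verts G"
    and D: "connected_graph (G \<restriction> D)" "D \<subseteq> verts G"
    and meet: "C \<inter> D \<noteq> {} \<or> (\<exists>x\<in>C. \<exists>y\<in>D. x \<rightarrow>\<^bsub>G\<^esub> y)"
  shows "connected_graph (G \<restriction> (C \<union> D))"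
proof -
  have ne: "C \<noteq> {}" "D \<noteq> {}"
    using C D by (simp_all add: connected_induce_subgraph_iff_cut)
  have "\<exists>x\<in>X. \<exists>y\<in>C \<union> D - X. x \<rightarrow>\<^bsub>G\<^esub> y" if X: "X \<noteq> {}" "X \<subset> C \<union> D" for X
  proof -
    consider (splits_C) "C \<inter> X \<noteq> {}" "\<not> C \<subseteq> X" | (splits_D) "D \<inter> X \<noteq> {}" "\<not> D \<subseteq> X"
      | (contains_C) "C \<subseteq> X" "D \<inter> X = {}" | (contains_D) "D \<subseteq> X" "C \<inter> X = {}"
      using X by blast
    then show ?thesis
    proof cases
      case splits_C
      then show ?thesis using connected_induce_subgraph_cut[OF C, of X] by auto
    next
      case splits_D
      then show ?thesis using connected_induce_subgraph_cut[OF D, of X] by auto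
    next
      case contains_C
      then show ?thesis using meet ne by blast
    next
      case contains_D
      then show ?thesis using meet ne arcs_ends_symmetric[OF sym_arcs] by blast
    qed
  qed
  then show ?thesis
    using C(2) D(2) ne by (subst connected_induce_subgraph_iff_cut) auto
qed

lemma connected_induce_subgraph_insert:
  assumes "connected_graph (G \<restriction> C)" "C \<subseteq> verts G" "x \<in> C" "x \<rightarrow>\<^bsub>G\<^esub> y"
  shows "connected_graph (G \<restriction> (insert y C))"
  using connected_induce_subgraph_Un[OF assms(1,2) connected_induce_subgraph_singleton[of y]]
    assms(3,4)
  by (auto dest: adj_in_verts)

lemma ex_Supp_subset:
  assumes C: "connected_graph (G \<restriction> C)" "C \<subseteq> verts G" and "v \<in> C" "n < card C"
  shows "\<exists>S\<in>Supp n v G. S \<subseteq> C"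
  using \<open>n < card C\<close>
proof (induction n)
  case 0
  then show ?case
    using assms by (intro bexI[of _ "{}"]) (auto simp: Supp_def connected_induce_subgraph_singleton)
next
  case (Suc n)
  then obtain S where S: "S \<in> Supp n v G" "S \<subseteq> C" by auto
  then have fin: "finite S" and conn: "connected_graph (G \<restriction> insert v S)" and "card S = n" "v \<notin> S"
    using C(2) finite_subset[OF _ finite_verts, of S] by (auto simp: Supp_def)
  then have "insert v S \<noteq> C" using Suc.prems by auto
  then obtain x y where xy: "x \<in> insert v S" "y \<in> C - insert v S" "x \<rightarrow>\<^bsub>G\<^esub> y"
    using connected_induce_subgraph_cut[OF C, of "insert v S"] S(2) \<open>v \<in> C\<close> by auto
  have "connected_graph (G \<restriction> insert y (insert v S))"
    using connected_induce_subgraph_insert[OF conn _ xy(1,3)] C(2) S(2) \<open>v \<in> C\<close> by blast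
  then have "insert y S \<in> Supp (Suc n) v G"
    using fin xy C(2) S(2) \<open>card S = n\<close> \<open>v \<notin> S\<close> by (auto simp: Supp_def insert_commute)
  then show ?case using S(2) xy(2) by blast
qed

lemma component_of_induce_subgraphD:
  assumes "component_of_graph (G \<restriction> A) C" "A \<subseteq> verts G"
  shows "verts C \<subseteq> A" "connected_graph (G \<restriction> verts C)"
proof -
  have C: "induced_subgraph C (G \<restriction> A)" "connected_graph C"
    using assms(1) pre_digraph.induced_subgraphI_arc_mono[OF _ arc_mono_connected]
    by (auto simp: component_of_graph_def pre_digraph.max_subgraph_def)
  then show "verts C \<subseteq> A" by (auto simp: induced_subgraph_def subgraph_def)
  then have "C = G \<restriction> verts C"
    using wf_digraph.induce_eq_iff_induced[OF wellformed_induce_subgraph C(1)]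
    by (simp add: induce_subgraph_induce_subgraph)
  with C(2) show "connected_graph (G \<restriction> verts C)" by simp
qed

lemma component_of_induce_subgraphI:
  assumes "D \<subseteq> A" "A \<subseteq> verts G" "connected_graph (G \<restriction> D)"
    and maximal: "\<And>D'. \<lbrakk>D \<subseteq> D'; D' \<subseteq> A; connected_graph (G \<restriction> D')\<rbrakk> \<Longrightarrow> D' = D"
  shows "component_of_graph (G \<restriction> A) (G \<restriction> D)"
  unfolding component_of_graph_def
proof (rule pre_digraph.max_subgraphI)
  interpret A: graph "G \<restriction> A" using assms(2) by (rule graph_induce_subgraph)
  show "connected_graph (G \<restriction> D)" by fact
  have D: "induced_subgraph (G \<restriction> D) (G \<restriction> A)"
    using A.induced_induce[of D] assms(1) by (simp add: induce_subgraph_induce_subgraph)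
  then show "subgraph (G \<restriction> D) (G \<restriction> A)" by blast
  fix H assume H: "G \<restriction> D \<noteq> H" "subgraph (G \<restriction> D) H" "subgraph H (G \<restriction> A)"
  show "\<not> connected_graph H"
  proof
    assume "connected_graph H"
    then have "connected_graph ((G \<restriction> A) \<restriction> verts H)"
      using arc_mono_connected subgraph_induce_subgraphI2[OF H(3)] unfolding arc_mono_def
      by (metis induce_subgraph_verts)
    moreover have "verts H \<subseteq> A" "D \<subseteq> verts H" using H by (auto simp: subgraph_def)
    ultimately have "verts H = D" using maximal by (simp add: induce_subgraph_induce_subgraph)
    then have "H = G \<restriction> D"
      using D H by (auto simp: pre_digraph.induced_subgraph_altdef2 pre_digraph.max_subgraph_def)
    with H(1) show False by simp
  qed
qed

lemma ex_component_of_induce_subgraph: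
  assumes "C \<subseteq> A" "A \<subseteq> verts G" "connected_graph (G \<restriction> C)"
  shows "\<exists>D. C \<subseteq> D \<and> component_of_graph (G \<restriction> A) (G \<restriction> D)"
proof -
  let ?\<C> = "{D. C \<subseteq> D \<and> D \<subseteq> A \<and> connected_graph (G \<restriction> D)}"
  have "?\<C> \<subseteq> Pow (verts G)" using assms(2) by blast
  then have "finite ?\<C>" using finite_verts by (meson finite_Pow_iff finite_subset)
  from finite_has_maximal2[OF this, of C] obtain D where D: "D \<in> ?\<C>"
    and maximal: "\<forall>D'\<in>?\<C>. D \<subseteq> D' \<longrightarrow> D = D'"
    using assms by auto
  have "component_of_graph (G \<restriction> A) (G \<restriction> D)"
  proof (rule component_of_induce_subgraphI)
    fix D' assume D': "D \<subseteq> D'" "D' \<subseteq> A" "connected_graph (G \<restriction> D')"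
    then show "D' = D" using D by (intro maximal[rule_format, symmetric]) auto
  qed (use D assms(2) in simp_all)
  then show ?thesis using D by (intro exI[of _ D]) simp
qed

lemma in_Ind_iff:
  "A \<in> Ind r G \<longleftrightarrow> A \<subseteq> verts G \<and> (\<forall>C\<subseteq>A. connected_graph (G \<restriction> C) \<longrightarrow> card C \<le> r)"
proof (intro iffI conjI allI impI)
  assume A: "A \<in> Ind r G"
  then show AV: "A \<subseteq> verts G" by (simp add: Ind_def)
  fix C assume C: "C \<subseteq> A" "connected_graph (G \<restriction> C)"
  then obtain D where D: "C \<subseteq> D" "component_of_graph (G \<restriction> A) (G \<restriction> D)"
    using ex_component_of_induce_subgraph AV by blast
  then have "D \<subseteq> verts G" using component_of_induce_subgraphD(1)[OF D(2)] AV by auto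
  then have "card C \<le> card D" using D(1) finite_verts by (meson card_mono finite_subset)
  then show "card C \<le> r" using A D(2) by (force simp: Ind_def)
next
  assume "A \<subseteq> verts G \<and> (\<forall>C\<subseteq>A. connected_graph (G \<restriction> C) \<longrightarrow> card C \<le> r)"
  then show "A \<in> Ind r G"
    using component_of_induce_subgraphD by (auto simp: Ind_def)
qed

lemma finite_complex_Ind: "finite_complex (verts G) (Ind r G)"
  using finite_verts unfolding finite_complex_def
  by (intro conjI subsetI ballI) (simp_all add: in_Ind_iff subset_iff)

lemma Ind_subset: "\<lbrakk>A \<in> Ind r G; B \<subseteq> A\<rbrakk> \<Longrightarrow> B \<in> Ind r G"
  by (rule finite_complex_downward[OF finite_complex_Ind])

lemma in_Ind_delete_verts_iff: "A \<in> Ind r (delete_verts G U) \<longleftrightarrow> A \<in> Ind r G \<and> A \<inter> U = {}"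
proof -
  interpret D: graph "delete_verts G U"
    unfolding delete_verts_def by (rule graph_induce_subgraph) blast
  have "delete_verts G U \<restriction> C = G \<restriction> C" if "C \<subseteq> verts G - U" for C
    using that unfolding delete_verts_def by (rule induce_subgraph_induce_subgraph)
  moreover have "verts (delete_verts G U) = verts G - U" by (simp add: delete_verts_def)
  ultimately have "A \<in> Ind r (delete_verts G U) \<longleftrightarrow>
      A \<subseteq> verts G - U \<and> (\<forall>C\<subseteq>A. connected_graph (G \<restriction> C) \<longrightarrow> card C \<le> r)"
    unfolding D.in_Ind_iff by (metis subset_trans)
  then show ?thesis by (auto simp: in_Ind_iff)
qed

lemma finite_complex_Ind_delete_verts: "finite_complex (verts G) (Ind r (delete_verts G U))"
proof -
  note K = finite_complex_Ind[of r]
  show ?thesis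
    unfolding finite_complex_def
  proof (intro conjI ballI subsetI)
    show "finite (verts G)" by (rule finite_verts)
  qed (use finite_complex_face_subset[OF K] finite_complex_empty[OF K] finite_complex_downward[OF K]
      in \<open>auto simp: in_Ind_delete_verts_iff\<close>)
qed

end

section \<open>Dominating connected supports\<close>

locale dominating_supports = graph G for G :: "('a, 'b) pre_digraph" +
  fixes r :: nat and v :: 'a
  assumes r_pos: "1 \<le> r" and v_in: "v \<in> verts G"
    and Supp_connected: "Supp_connected r v G"
    and nbhd_subset: "\<And>S. S \<in> Supp r v G \<Longrightarrow> nbhd G {v} \<subseteq> closed_nbhd G S"
begin

abbreviation "V \<equiv> verts G"
abbreviation "K \<equiv> Ind r G"
abbreviation "supports \<equiv> Supp r v G"
abbreviation "L S \<equiv> Ind r (delete_verts G (closed_nbhd G S))"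

lemma
  assumes "S \<in> supports"
  shows support_subset: "S \<subseteq> V" and v_notin_support: "v \<notin> S" and card_support: "card S = r"
    and connected_insert_support: "connected_graph (G \<restriction> insert v S)"
    and connected_support: "connected_graph (G \<restriction> S)"
  using assms Supp_connected by (simp_all add: Supp_def Supp_connected_def)

lemma finite_support: "S \<in> supports \<Longrightarrow> finite S"
  using support_subset finite_verts by (rule finite_subset)

lemma support_nonempty: "S \<in> supports \<Longrightarrow> S \<noteq> {}"
  using card_support r_pos by fastforce

lemma finite_supports: "finite supports"
  using support_subset finite_verts by (intro finite_subset[of supports "Pow V"]) auto

lemma insert_v_in_K:
  assumes "A \<in> K" "\<And>S. S \<in> supports \<Longrightarrow> \<not> S \<subseteq> A"
  shows "insert v A \<in> K"
  unfolding in_Ind_iff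
proof (intro conjI allI impI)
  show A: "insert v A \<subseteq> V" using assms(1) v_in by (auto simp: in_Ind_iff)
  fix C assume C: "C \<subseteq> insert v A" "connected_graph (G \<restriction> C)"
  show "card C \<le> r"
  proof (rule ccontr)
    assume "\<not> card C \<le> r"
    then have "v \<in> C" "r < card C" using C assms(1) by (auto simp: in_Ind_iff)
    then obtain S where S: "S \<in> supports" "S \<subseteq> C"
      using ex_Supp_subset[OF C(2)] C(1) A by blast
    then have "S \<subseteq> A" using v_notin_support C(1) by blast
    with assms(2) S(1) show False by blast
  qed
qed

lemma support_isolated:
  assumes S: "S \<in> supports" and A: "S \<subseteq> A" "A \<in> K"
  shows "A \<inter> closed_nbhd G S = S"
proof -
  have "a \<in> S" if "a \<in> A" "s \<in> S" "s \<rightarrow>\<^bsub>G\<^esub> a" for a s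
  proof (rule ccontr)
    assume "a \<notin> S"
    have "connected_graph (G \<restriction> insert a S)"
      using connected_induce_subgraph_insert[OF connected_support[OF S] support_subset[OF S]] that
      by blast
    moreover have "insert a S \<subseteq> A" using A(1) that by blast
    ultimately have "card (insert a S) \<le> r" using A(2) by (simp add: in_Ind_iff)
    then show False using \<open>a \<notin> S\<close> card_support[OF S] finite_support[OF S] by simp
  qed
  then show ?thesis using A(1) by (auto simp: closed_nbhd_def nbhd_def)
qed

lemma v_adjacent_support:
  assumes S: "S \<in> supports"
  obtains w where "w \<in> S" "v \<rightarrow>\<^bsub>G\<^esub> w"
proof -
  have "insert v S \<subseteq> V" "{v} \<subset> insert v S"
    using support_subset[OF S] v_notin_support[OF S] support_nonempty[OF S] v_in by auto
  then show ?thesis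
    using connected_induce_subgraph_cut[OF connected_insert_support[OF S], of "{v}"] that by auto
qed

lemma support_unique:
  assumes S: "S \<in> supports" "S' \<in> supports" and A: "S \<subseteq> A" "S' \<subseteq> A" "A \<in> K"
  shows "S = S'"
proof -
  obtain w where w: "w \<in> S'" "v \<rightarrow>\<^bsub>G\<^esub> w" using S(2) by (rule v_adjacent_support)
  then have "w \<in> closed_nbhd G S"
    using nbhd_subset[OF S(1)] support_subset[OF S(2)] by (auto simp: nbhd_def)
  then have "w \<in> S" using w support_isolated[OF S(1) A(1,3)] A(2) by blast
  with w have "connected_graph (G \<restriction> (S \<union> S'))"
    using connected_induce_subgraph_Un[OF connected_support[OF S(1)] support_subset[OF S(1)]
        connected_support[OF S(2)] support_subset[OF S(2)]] by blast
  then have "card (S \<union> S') \<le> r" using A by (simp add: in_Ind_iff)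
  then show ?thesis
    using S card_support finite_support by (metis Un_upper1 Un_upper2 card_seteq finite_UnI)
qed

lemma facet_join_in_K_iff:
  assumes S: "S \<in> supports" "S \<subseteq> A"
  shows "A \<in> K \<longleftrightarrow> A - S \<in> L S"
proof
  assume "A \<in> K"
  then show "A - S \<in> L S"
    using support_isolated[OF S] Ind_subset by (auto simp: in_Ind_delete_verts_iff)
next
  assume "A - S \<in> L S"
  then have link: "A - S \<in> K" "(A - S) \<inter> closed_nbhd G S = {}"
    by (auto simp: in_Ind_delete_verts_iff)
  show "A \<in> K"
    unfolding in_Ind_iff
  proof (intro conjI allI impI)
    show A: "A \<subseteq> V" using link(1) support_subset[OF S(1)] by (auto simp: in_Ind_iff)
    fix C assume C: "C \<subseteq> A" "connected_graph (G \<restriction> C)"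
    consider (in_link) "C \<subseteq> A - S" | (in_support) "C \<subseteq> S" | (mixed) "C \<inter> S \<noteq> {}" "\<not> C \<subseteq> S"
      using C(1) by blast
    then show "card C \<le> r"
    proof cases
      case in_link
      then show ?thesis using C(2) link(1) by (simp add: in_Ind_iff)
    next
      case in_support
      then show ?thesis using card_support[OF S(1)] finite_support[OF S(1)] card_mono by blast
    next
      case mixed
      then obtain x y where "x \<in> C \<inter> S" "y \<in> C - S" "x \<rightarrow>\<^bsub>G\<^esub> y"
        using connected_induce_subgraph_cut[OF C(2), of S] C(1) A by auto
      then show ?thesis using link(2) C(1) A by (auto simp: closed_nbhd_def nbhd_def)
    qed
  qed
qed

section \<open>Collapsing the star of the vertex\<close>

abbreviation "points_K \<equiv> signed_join V {} K"

lemma realization_K: "realization K = top_of_set points_K"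
  by (rule realization_eq_signed_join[OF finite_complex_Ind])

lemma depth_pos_subset_carrier:
  assumes "S \<in> supports" "0 < depth S x"
  shows "S \<subseteq> {a. x a \<noteq> 0}"
  using depth_le[OF finite_support[OF assms(1)] _ assms(2)] assms(2) by force

sublocale facets: exclusive_facets V "{}" K supports r
proof
  fix x S S' assume x: "x \<in> points_K"
    and S: "S \<in> supports" "S' \<in> supports" "0 < depth S x" "0 < depth S' x"
  have "{a. x a \<noteq> 0} \<in> K" using signed_join_face[OF x] by simp
  then show "S = S'"
    using support_unique[OF S(1,2) depth_pos_subset_carrier[OF S(1,3)]
      depth_pos_subset_carrier[OF S(2,4)]] by blast
qed (use finite_complex_Ind finite_supports r_pos support_subset card_support in auto)

lemma insert_v_carrier_in_K:
  assumes "x \<in> boundary_points supports points_K"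
  shows "insert v {a. x a \<noteq> 0} \<in> K"
proof (rule insert_v_in_K)
  have x: "x \<in> points_K" using assms boundary_points_subset by blast
  show "{a. x a \<noteq> 0} \<in> K" using signed_join_face[OF x] by simp
  fix S assume "S \<in> supports"
  then obtain s where "s \<in> S" "x s \<le> 0" using assms facets.boundary_points_iff by blast
  moreover have "0 \<le> x s" using signed_join_nonneg[OF x] by simp
  ultimately show "\<not> S \<subseteq> {a. x a \<noteq> 0}" by force
qed

lemma line_to_v_in_points_K:
  assumes x: "x \<in> boundary_points supports points_K" and t: "t \<in> {0..1}"
  shows "(\<lambda>a. (1 - t) * x a + axis_point v t a) \<in> points_K" (is "?y \<in> _")
proof -
  have points: "x \<in> points_K" using x boundary_points_subset by blast
  have nonneg: "0 \<le> x a" for a using signed_join_nonneg[OF points] by simp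
  have "(\<Sum>a\<in>V. \<bar>?y a\<bar>) = (\<Sum>a\<in>V. (1 - t) * \<bar>x a\<bar> + \<bar>axis_point v t a\<bar>)"
    using nonneg t by (intro sum.cong) (auto simp: axis_point_def)
  also have "\<dots> = 1"
    using signed_join_sum[OF points] t sum_abs_axis_point[OF finite_verts v_in]
    by (simp add: sum.distrib flip: sum_distrib_left)
  finally have "(\<Sum>a\<in>V. \<bar>?y a\<bar>) = 1" .
  moreover have "{a. ?y a \<noteq> 0} \<in> K"
    by (rule Ind_subset[OF insert_v_carrier_in_K[OF x]])
      (auto simp: axis_point_def split: if_splits)
  moreover have "?y a = 0" if "a \<notin> V" for a
    using that signed_join_outside[OF points that] v_in by (auto simp: axis_point_def)
  moreover have "0 \<le> ?y a" for a using nonneg t by (simp add: axis_point_def)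
  ultimately show ?thesis by (simp add: signed_join_def)
qed

lemma line_to_v_in_boundary_points:
  assumes x: "x \<in> boundary_points supports points_K" and t: "t \<in> {0..1}"
  shows "(\<lambda>a. (1 - t) * x a + axis_point v t a) \<in> boundary_points supports points_K" (is "?y \<in> _")
proof -
  have "\<exists>s\<in>S. ?y s \<le> 0" if S: "S \<in> supports" for S
  proof -
    obtain s where s: "s \<in> S" "x s \<le> 0" using x S facets.boundary_points_iff by blast
    then have "?y s \<le> 0" using v_notin_support[OF S] t
      by (auto simp: axis_point_def mult_nonneg_nonpos)
    with s(1) show ?thesis by blast
  qed
  then show ?thesis using line_to_v_in_points_K[OF assms] by (simp add: facets.boundary_points_iff)
qed

lemma v_in_boundary_points: "axis_point v 1 \<in> boundary_points supports points_K"
proof -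
  have "{v} \<in> K"
    using insert_v_in_K[of "{}"] support_nonempty finite_complex_empty[OF finite_complex_Ind]
    by auto
  then have "axis_point v 1 \<in> points_K"
    using v_in by (intro axis_point_in_signed_join) auto
  moreover have "\<exists>s\<in>S. axis_point v 1 s \<le> 0" if S: "S \<in> supports" for S
    using v_notin_support[OF S] support_nonempty[OF S] by (auto simp: axis_point_def)
  ultimately show ?thesis by (simp add: facets.boundary_points_iff)
qed

lemma shrinkable_star:
  "shrinkable (top_of_set points_K) (boundary_points supports points_K) (axis_point v 1)"
proof (rule facets.shrinkable_boundary_points)
  let ?A = "boundary_points supports points_K"
  define h where "h q = (\<lambda>a. (1 - fst q) * snd q a + axis_point v (fst q) a)"
    for q :: "real \<times> ('a \<Rightarrow> real)"
  have h_in: "h (t, x) \<in> ?A" if "t \<in> {0..1}" "x \<in> ?A" for t x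
    using line_to_v_in_boundary_points[OF that(2,1)] by (simp add: h_def)
  have "continuous_on ({0..1::real} \<times> ?A) (\<lambda>q. axis_point v (fst q) a)" for a
    by (cases "a = v") (auto intro!: continuous_intros)
  then have "continuous_on ({0..1} \<times> ?A) h"
    unfolding h_def
    by (intro continuous_on_coordinatewise_then_product continuous_intros
      continuous_on_snd_coordinate)
  then have "continuous_map (prod_topology unit_interval (top_of_set ?A)) (top_of_set ?A) h"
    using h_in by (auto simp: continuous_map_in_subtopology)
  moreover have "h (t, axis_point v 1) = axis_point v 1" for t
    by (auto simp: h_def axis_point_def)
  moreover have "h (0, x) = x" "h (1, x) = axis_point v 1" for x
    by (auto simp: h_def axis_point_def)
  ultimately have "shrinking_homotopy (top_of_set ?A) ?A (axis_point v 1) h"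
    using h_in by (simp add: shrinking_homotopy_def)
  then show "shrinkable (top_of_set ?A) ?A (axis_point v 1)"
    using v_in_boundary_points by (auto simp: shrinkable_def)
qed

lemma realization_K_homotopy_equivalent_collapse:
  "realization K homotopy_equivalent_space top_of_set (collapse supports ` points_K)"
  unfolding realization_K
  using shrinkable_star facets.quotient_map_collapse
  by (rule shrinkable_quotient_homotopy_equivalent) (simp add: facets.collapse_eq_iff)

section \<open>Collapsing the wedge of suspensions\<close>

abbreviation "join_L S \<equiv> signed_join V S (L S)"
abbreviation "susp_L S \<equiv> iterated_suspension r (realization (L S))"
abbreviation "susp_wedge \<equiv> wedge supports susp_L (\<lambda>_. North)"

definition enumeration :: "'a set \<Rightarrow> nat \<Rightarrow> 'a" where
  "enumeration S = (SOME s. bij_betw s {..<r} S)"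

abbreviation "apex S \<equiv> enumeration S (r - 1)"
abbreviation "coords S \<equiv> octahedral_coordinates (enumeration S) r"

lemma bij_betw_enumeration:
  assumes "S \<in> supports"
  shows "bij_betw (enumeration S) {..<r} S"
proof -
  have "\<exists>s. bij_betw s {..<r} S"
    using ex_bij_betw_nat_finite[OF finite_support[OF assms]] card_support[OF assms]
    by (auto simp: atLeast0LessThan)
  then show ?thesis unfolding enumeration_def by (rule someI_ex)
qed

lemma apex_in: "S \<in> supports \<Longrightarrow> apex S \<in> S"
  using bij_betw_enumeration r_pos by (force simp: bij_betw_def)

lemma homeomorphic_map_coords:
  assumes "S \<in> supports"
  shows "homeomorphic_map (susp_L S) (top_of_set (join_L S)) (coords S)"
proof -
  have "\<Union>(L S) \<inter> S = {}" by (auto simp: in_Ind_delete_verts_iff closed_nbhd_def)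
  then show ?thesis
    using homeomorphic_map_octahedral_coordinates[of V "L S" "enumeration S" r]
      finite_complex_Ind_delete_verts
      bij_betw_enumeration[OF assms] support_subset[OF assms] by (simp add: bij_betw_def)
qed

lemma coords_image: "S \<in> supports \<Longrightarrow> coords S ` topspace (susp_L S) = join_L S"
  using homeomorphic_imp_surjective_map[OF homeomorphic_map_coords] by simp

lemma coords_North: "coords S North = axis_point (apex S) (- 1)"
  using r_pos by (rule octahedral_coordinates_North)

lemma depth_coords_North:
  assumes "S \<in> supports"
  shows "depth S (coords S North) = 0"
  unfolding facets.depth_facet_eq_0_iff[OF assms]
  using apex_in[OF assms] by (intro bexI[of _ "apex S"]) (auto simp: coords_North)

lemma North_in_susp_L: "North \<in> topspace (susp_L S)"
  using r_pos by (rule North_in_iterated_suspension)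

lemma exclusive_facets_support:
  assumes "S \<in> supports"
  shows "exclusive_facets V S (L S) {S} r"
  using exclusive_facets_singleton[OF finite_complex_Ind_delete_verts support_subset[OF assms]
    apex_in[OF assms]]
    card_support[OF assms] by simp

lemma compact_space_susp_L:
  assumes "S \<in> supports"
  shows "compact_space (susp_L S)"
  using finite_complex_Ind_delete_verts homeomorphic_map_coords[OF assms]
  by (rule compact_space_homeomorphic_signed_join)

definition susp_boundary :: "'a set \<Rightarrow> ('a \<Rightarrow> real) susp_point set" where
  "susp_boundary S = {y \<in> topspace (susp_L S). depth S (coords S y) = 0}"

definition wedge_boundary :: "('a set \<times> ('a \<Rightarrow> real) susp_point) option set" where
  "wedge_boundary = insert None (wedge_proj (\<lambda>_. North) ` Sigma supports susp_boundary)"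

lemma shrinkable_wedge_boundary: "shrinkable susp_wedge wedge_boundary None"
  unfolding wedge_boundary_def
proof (rule shrinkable_wedge)
  fix S assume S: "S \<in> supports"
  show "shrinkable (susp_L S) (susp_boundary S) North"
  proof (rule shrinkable_homeomorphic[OF homeomorphic_map_coords[OF S]])
    have "coords S ` susp_boundary S = boundary_points {S} (join_L S)"
      unfolding susp_boundary_def boundary_points_def coords_image[OF S, symmetric] by auto
    then show "shrinkable (top_of_set (join_L S)) (coords S ` susp_boundary S) (coords S North)"
      using shrinkable_octahedral_boundary[OF finite_complex_Ind_delete_verts support_subset[OF S]
        apex_in[OF S]]
      by (simp add: coords_North)
    show "susp_boundary S \<subseteq> topspace (susp_L S)" by (auto simp: susp_boundary_def)
    show "North \<in> susp_boundary S" using North_in_susp_L depth_coords_North[OF S]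
      by (simp add: susp_boundary_def)
  qed
qed

definition wedge_collapse :: "('a set \<times> ('a \<Rightarrow> real) susp_point) option \<Rightarrow> 'a \<Rightarrow> real" where
  "wedge_collapse w = (case w of None \<Rightarrow> (\<lambda>_. 0) | Some (S, y) \<Rightarrow> collapse {S} (coords S y))"

lemma wedge_collapse_wedge_proj:
  "S \<in> supports \<Longrightarrow> wedge_collapse (wedge_proj (\<lambda>_. North) (S, y)) = collapse {S} (coords S y)"
  by (auto simp: wedge_collapse_def wedge_proj_def collapse_def depth_coords_North)

lemma wedge_collapse_boundary: "w \<in> wedge_boundary \<Longrightarrow> wedge_collapse w = (\<lambda>_. 0)"
  unfolding wedge_boundary_def
  by (auto simp: wedge_collapse_wedge_proj collapse_def susp_boundary_def)
    (simp add: wedge_collapse_def)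

lemma join_L_iff_points_K:
  assumes "S \<in> supports" "0 < depth S x"
  shows "x \<in> join_L S \<longleftrightarrow> x \<in> points_K"
proof -
  have "{a. x a \<noteq> 0} - S = {a. a \<notin> S \<and> x a \<noteq> 0}" by blast
  then have "{a. x a \<noteq> 0} \<in> K \<longleftrightarrow> {a. a \<notin> S \<and> x a \<noteq> 0} \<in> L S"
    using facet_join_in_K_iff[OF assms(1) depth_pos_subset_carrier[OF assms]] by simp
  moreover have "0 \<le> x s" if "s \<in> S" for s
    using depth_le[OF finite_support[OF assms(1)] that assms(2)] assms(2) by simp
  then have "(\<forall>a. 0 \<le> x a) \<longleftrightarrow> (\<forall>a. a \<notin> S \<longrightarrow> 0 \<le> x a)" by blast
  ultimately show ?thesis by (simp add: signed_join_def)
qed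

lemma collapse_singleton_eq:
  assumes "S \<in> supports" "x \<in> points_K" "0 < depth S x"
  shows "collapse {S} x = collapse supports x"
  using facets.total_depth_eq[OF assms(2,1,3)] by (simp add: collapse_def)

lemma wedge_interiorE:
  assumes "w \<in> topspace susp_wedge" "w \<notin> wedge_boundary"
  obtains S y where "w = Some (S, y)" "S \<in> supports" "y \<in> topspace (susp_L S)"
    "coords S y \<in> points_K" "0 < depth S (coords S y)"
      "wedge_collapse w = collapse supports (coords S y)"
proof -
  obtain S y where w: "w = wedge_proj (\<lambda>_. North) (S, y)" and S: "S \<in> supports"
    and y: "y \<in> topspace (susp_L S)"
    using assms by (auto simp: topspace_wedge wedge_boundary_def)
  then have pos: "0 < depth S (coords S y)"
    using assms(2) depth_nonneg[of S "coords S y"]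
    by (force simp: wedge_boundary_def susp_boundary_def)
  then have "w = Some (S, y)"
    using w depth_coords_North[OF S] by (auto simp: wedge_proj_def)
  moreover have point: "coords S y \<in> points_K"
    using coords_image[OF S] y join_L_iff_points_K[OF S pos] by blast
  moreover have "wedge_collapse w = collapse supports (coords S y)"
    using w S collapse_singleton_eq[OF S point pos] by (simp add: wedge_collapse_wedge_proj)
  ultimately show ?thesis using that S y pos by blast
qed

lemma interior_not_in_boundary_points:
  "\<lbrakk>S \<in> supports; 0 < depth S x\<rbrakk> \<Longrightarrow> x \<notin> boundary_points supports points_K"
  by (force simp: boundary_points_def facets.total_depth_eq_0_iff)

lemma wedge_collapse_eq_0_iff:
  assumes "w \<in> topspace susp_wedge"
  shows "wedge_collapse w = (\<lambda>_. 0) \<longleftrightarrow> w \<in> wedge_boundary"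
proof
  assume zero: "wedge_collapse w = (\<lambda>_. 0)"
  show "w \<in> wedge_boundary"
  proof (rule ccontr)
    assume "w \<notin> wedge_boundary"
    with assms obtain S y where "S \<in> supports" "coords S y \<in> points_K" "0 < depth S (coords S y)"
      "wedge_collapse w = collapse supports (coords S y)"
      by (rule wedge_interiorE)
    then show False
      using zero facets.collapse_eq_0_iff interior_not_in_boundary_points by metis
  qed
qed (rule wedge_collapse_boundary)

lemma wedge_collapse_inject:
  assumes w: "w \<in> topspace susp_wedge" "w \<notin> wedge_boundary"
    and w': "w' \<in> topspace susp_wedge" "w' \<notin> wedge_boundary"
    and eq: "wedge_collapse w = wedge_collapse w'"
  shows "w = w'"
proof -
  obtain S y where w_eq: "w = Some (S, y)" and S: "S \<in> supports" and y: "y \<in> topspace (susp_L S)"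
    and point: "coords S y \<in> points_K" and pos: "0 < depth S (coords S y)"
    and image: "wedge_collapse w = collapse supports (coords S y)"
    using w by (rule wedge_interiorE)
  obtain S' y' where w'_eq: "w' = Some (S', y')" and S': "S' \<in> supports"
    and y': "y' \<in> topspace (susp_L S')"
    and point': "coords S' y' \<in> points_K" and pos': "0 < depth S' (coords S' y')"
    and image': "wedge_collapse w' = collapse supports (coords S' y')"
    using w' by (rule wedge_interiorE)
  have same_point: "coords S y = coords S' y'"
    using eq image image' facets.collapse_eq_iff[OF point point']
      interior_not_in_boundary_points[OF S pos]
    by simp
  then have "S = S'" using facets.exclusive[OF point S S' pos] pos' by simp
  moreover from this have "y = y'"
    using inj_onD[OF homeomorphic_imp_injective_map[OF homeomorphic_map_coords[OF S]] _ y]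
      same_point y'
    by simp
  ultimately show ?thesis using w_eq w'_eq by simp
qed

lemma wedge_collapse_eq_iff:
  assumes "w \<in> topspace susp_wedge" "w' \<in> topspace susp_wedge"
  shows "wedge_collapse w = wedge_collapse w' \<longleftrightarrow> w = w' \<or> w \<in> wedge_boundary \<and> w' \<in> wedge_boundary"
  using wedge_collapse_inject wedge_collapse_eq_0_iff assms by metis

lemma wedge_collapse_image: "wedge_collapse ` topspace susp_wedge = collapse supports ` points_K"
proof (intro equalityI subsetI)
  fix z assume "z \<in> wedge_collapse ` topspace susp_wedge"
  then obtain w where w: "w \<in> topspace susp_wedge" "z = wedge_collapse w" by blast
  show "z \<in> collapse supports ` points_K"
  proof (cases "w \<in> wedge_boundary")
    case True
    have "axis_point v 1 \<in> points_K" using v_in_boundary_points by (simp add: boundary_points_def)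
    then have "collapse supports (axis_point v 1) = z"
      using True w(2) v_in_boundary_points
      by (simp add: wedge_collapse_boundary facets.collapse_eq_0_iff)
    then show ?thesis using \<open>axis_point v 1 \<in> points_K\<close> by blast
  next
    case False
    with w(1) show ?thesis by (rule wedge_interiorE) (use w(2) in blast)
  qed
next
  fix z assume "z \<in> collapse supports ` points_K"
  then obtain x where x: "x \<in> points_K" "z = collapse supports x" by blast
  show "z \<in> wedge_collapse ` topspace susp_wedge"
  proof (cases "total_depth supports x = 0")
    case True
    then have "z = wedge_collapse None" using x(2) by (simp add: collapse_def wedge_collapse_def)
    then show ?thesis by (simp add: topspace_wedge)
  next
    case False
    then obtain S where S: "S \<in> supports" "0 < depth S x" by (rule facets.total_depth_nonzeroE)
    then have "x \<in> coords S ` topspace (susp_L S)"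
      using x(1) join_L_iff_points_K[OF S] coords_image by simp
    then obtain y where y: "y \<in> topspace (susp_L S)" "x = coords S y" by blast
    then have "z = wedge_collapse (wedge_proj (\<lambda>_. North) (S, y))"
      using x S by (simp add: wedge_collapse_wedge_proj collapse_singleton_eq)
    then show ?thesis using S(1) y(1) by (auto simp: topspace_wedge)
  qed
qed

lemma quotient_map_wedge_collapse:
  "quotient_map susp_wedge (top_of_set (collapse supports ` points_K)) wedge_collapse"
proof (rule continuous_imp_quotient_map)
  have "continuous_map susp_wedge euclidean wedge_collapse"
    unfolding wedge_def
  proof (rule continuous_map_from_final_topology)
    show "continuous_map (sum_topology susp_L supports) euclidean
        (wedge_collapse \<circ> wedge_proj (\<lambda>_. North))"
    proof (rule continuous_map_from_sum_topology)
      fix S assume S: "S \<in> supports"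
      have "continuous_map (top_of_set (join_L S)) euclidean (collapse {S})"
        using exclusive_facets.continuous_on_collapse[OF exclusive_facets_support[OF S]] by simp
      with homeomorphic_imp_continuous_map[OF homeomorphic_map_coords[OF S]]
      have "continuous_map (susp_L S) euclidean (collapse {S} \<circ> coords S)"
        by (rule continuous_map_compose)
      then show "continuous_map (susp_L S) euclidean
          (\<lambda>y. (wedge_collapse \<circ> wedge_proj (\<lambda>_. North)) (S, y))"
        by (simp add: o_def wedge_collapse_wedge_proj[OF S])
    qed
  qed auto
  then show "continuous_map susp_wedge (top_of_set (collapse supports ` points_K)) wedge_collapse"
    using wedge_collapse_image by (auto simp: continuous_map_in_subtopology)
  show "compact_space susp_wedge"
    using finite_supports compact_space_susp_L by (rule compact_space_wedge)
qed (auto simp: Hausdorff_space_top_of_set_fun wedge_collapse_image)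

lemma susp_wedge_homotopy_equivalent_collapse:
  "susp_wedge homotopy_equivalent_space top_of_set (collapse supports ` points_K)"
  using shrinkable_wedge_boundary quotient_map_wedge_collapse wedge_collapse_eq_iff
  by (rule shrinkable_quotient_homotopy_equivalent)

end

theorem theorem4p2:
  fixes G :: "('a, 'b) pre_digraph" and r :: nat and v :: 'a
  assumes "graph G" and "connected_graph G"
    and "r \<ge> 1" and "v \<in> verts G"
    and "Supp_connected r v G"
    and "\<forall>S\<in>Supp r v G. nbhd G {v} \<subseteq> closed_nbhd G S"
  shows "realization (Ind r G) homotopy_equivalent_space
    wedge (Supp r v G)
      (\<lambda>S. iterated_suspension r (realization (Ind r (delete_verts G (closed_nbhd G S)))))
      (\<lambda>S. North)"
proof -
  interpret dominating_supports G r v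
    using assms by (intro dominating_supports.intro dominating_supports_axioms.intro) blast+
  have "top_of_set (collapse supports ` points_K) homotopy_equivalent_space susp_wedge"
    using susp_wedge_homotopy_equivalent_collapse
    by (rule homotopy_equivalent_space_sym[THEN iffD1])
  with realization_K_homotopy_equivalent_collapse show ?thesis
    by (rule homotopy_eqv_trans)
qed

end
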